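(* Let $q=4$. The groups $G_4$ and $G_4^*$ have the same orbits on planes and the same orbits on points. Consequently the $G_4$-orbits of planes are the sets of $\Gamma$-planes ($5$), $2_{\mathscr C}$-planes ($20$), $3_{\mathscr C}$-planes ($10$), $\overline{1_{\mathscr C}}$-planes ($30$), $0_{\mathscr C}$-planes ($20$), and the $G_4$-orbits of points are the sets of $\mathscr C$-points ($5$), T-points ($20$), $3_\Gamma$-points ($10$), $1_\Gamma$-points ($30$), $0_\Gamma$-points ($20$).
   Context: Notation. $\mathbb F_q$ is the field with $q$ elements, $\mathbb F_q^+=\mathbb F_q\cup\{\infty\}$. Points of $\mathrm{PG}(3,q)$ are written $\mathbf P(x_0,x_1,x_2,x_3)$ with $x$ a nonzero row vector up to scalars; $\boldsymbol\pi(c_0,c_1,c_2,c_3)$ is the plane $c_0x_0+c_1x_1+c_2x_2+c_3x_3=0$. Put $P(t)=\mathbf P(t^3,t^2,t,1)$ for $t\in\mathbb F_q$, $P(\infty)=\mathbf P(1,0,0,0)$, and $\mathscr C=\{P(t):t\in\mathbb F_q^+\}$ (the twisted cubic). The osculating planes are $\pi_{\rm osc}(t)=\boldsymbol\pi(1,-3t,3t^2,-t^3)$ ($t\in\mathbb F_q$) and $\pi_{\rm osc}(\infty)=\boldsymbol\pi(0,0,0,1)$; these $q+1$ planes are called $\Gamma$-planes. The tangent at $P(t)$, $t\in\mathbb F_q$, is the line through $P(t)$ and $\mathbf P(3t^2,2t,1,0)$; the tangent at $P(\infty)$ is the line through $\mathbf P(1,0,0,0)$ and $\mathbf P(0,1,0,0)$.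 $G_q$ is the group of all projectivities of $\mathrm{PG}(3,q)$ mapping $\mathscr C$ onto itself. For $a,b,c,d\in\mathbb F_q$, $ad-bc\ne0$, let $$M(a,b,c,d)=\begin{pmatrix} a^3&a^2c&ac^2&c^3\\ 3a^2b&a^2d+2abc&bc^2+2acd&3c^2d\\ 3ab^2&b^2c+2abd&ad^2+2bcd&3cd^2\\ b^3&b^2d&bd^2&d^3\end{pmatrix};$$ the projectivities $\mathbf P(x)\mapsto\mathbf P(xM(a,b,c,d))$ form the subgroup $G_q^*\cong PGL(2,q)$ of $G_q$ (critical subgroup). Plane types: $\Gamma$-plane = osculating plane; $\overline{1_{\mathscr C}}$-plane = non-osculating plane meeting $\mathscr C$ in exactly one point; $d_{\mathscr C}$-plane ($d\in\{0,2,3\}$) = plane meeting $\mathscr C$ in exactly $d$ points. Point types (for $q\not\equiv0\pmod 3$): $\mathscr C$-point = point of $\mathscr C$; T-point = point off $\mathscr C$ on some tangent; for $\mu\in\{0,1,3\}$, $\mu_\Gamma$-point = point off $\mathscr C$, on no tangent, lying on exactly $\mu$ $\Gamma$-planes. *)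

theory Defs
  imports "HOL-Analysis.Analysis"
begin

text \<open>Row vectors of length 4 over a field, and the projective space PG(3,q).
  A point P(x) of PG(3,q) is represented by the set of all nonzero scalar
  multiples of x (x nonzero); a plane is represented by its set of points.\<close>

type_synonym 'a vec4 = "'a ^ 4"
type_synonym 'a mat4 = "'a ^ 4 ^ 4"
type_synonym 'a point = "'a vec4 set"

definition vec4 :: "'a::zero \<Rightarrow> 'a \<Rightarrow> 'a \<Rightarrow> 'a \<Rightarrow> 'a vec4" where
  "vec4 a b c d = vector [a, b, c, d]"

definition dot4 :: "'a::comm_ring_1 vec4 \<Rightarrow> 'a vec4 \<Rightarrow> 'a" where
  "dot4 c x = (\<Sum>i\<in>UNIV. c $ i * x $ i)"

definition pt :: "'a::field vec4 \<Rightarrow> 'a point" where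
  "pt x = {c *s x | c. c \<noteq> 0}"

definition Points :: "'a::field point set" where
  "Points = {pt x | x. x \<noteq> 0}"

definition plane :: "'a::field vec4 \<Rightarrow> 'a point set" where
  "plane c = {pt x | x. x \<noteq> 0 \<and> dot4 c x = 0}"

definition Planes :: "'a::field point set set" where
  "Planes = {plane c | c. c \<noteq> 0}"

definition line :: "'a::field vec4 \<Rightarrow> 'a vec4 \<Rightarrow> 'a point set" where
  "line u v = {pt (a *s u + b *s v) | a b. a *s u + b *s v \<noteq> 0}"

definition pmap :: "'a::field mat4 \<Rightarrow> 'a point \<Rightarrow> 'a point" where
  "pmap M P = (\<lambda>x. x v* M) ` P"

definition plmap :: "'a::field mat4 \<Rightarrow> 'a point set \<Rightarrow> 'a point set" where
  "plmap M S = pmap M ` S"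

text \<open>Twisted cubic; \<open>None\<close> stands for \<open>\<infinity>\<close>, so \<open>'a option\<close> is \<open>\<bbbF>\<^sub>q\<^sup>+\<close>.\<close>
fun Pc :: "'a::field option \<Rightarrow> 'a point" where
  "Pc (Some t) = pt (vec4 (t^3) (t^2) t 1)"
| "Pc None = pt (vec4 1 0 0 0)"

definition TC :: "'a::field point set" where
  "TC = range Pc"

fun osc :: "'a::field option \<Rightarrow> 'a point set" where
  "osc (Some t) = plane (vec4 1 (-3*t) (3*t^2) (-(t^3)))"
| "osc None = plane (vec4 0 0 0 1)"

fun tangent :: "'a::field option \<Rightarrow> 'a point set" where
  "tangent (Some t) = line (vec4 (t^3) (t^2) t 1) (vec4 (3*t^2) (2*t) 1 0)"
| "tangent None = line (vec4 1 0 0 0) (vec4 0 1 0 0)"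

definition Gq :: "'a::field mat4 set" where
  "Gq = {M. invertible M \<and> pmap M ` TC = TC}"

definition Mabcd :: "'a::field \<Rightarrow> 'a \<Rightarrow> 'a \<Rightarrow> 'a \<Rightarrow> 'a mat4" where
  "Mabcd a b c d = vector [
     vec4 (a^3) (a^2*c) (a*c^2) (c^3),
     vec4 (3*a^2*b) (a^2*d + 2*a*b*c) (b*c^2 + 2*a*c*d) (3*c^2*d),
     vec4 (3*a*b^2) (b^2*c + 2*a*b*d) (a*d^2 + 2*b*c*d) (3*c*d^2),
     vec4 (b^3) (b^2*d) (b*d^2) (d^3)]"

definition Gq_star :: "'a::field mat4 set" where
  "Gq_star = {Mabcd a b c d | a b c d. a*d - b*c \<noteq> 0}"

definition orbit_pt :: "'a::field mat4 set \<Rightarrow> 'a point \<Rightarrow> 'a point set" where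
  "orbit_pt G P = {pmap M P | M. M \<in> G}"

definition orbit_pl :: "'a::field mat4 set \<Rightarrow> 'a point set \<Rightarrow> 'a point set set" where
  "orbit_pl G S = {plmap M S | M. M \<in> G}"

definition Gamma_planes :: "'a::field point set set" where
  "Gamma_planes = range osc"

definition dC_planes :: "nat \<Rightarrow> 'a::field point set set" where
  "dC_planes d = {S \<in> Planes. card (S \<inter> TC) = d}"

definition one_bar_planes :: "'a::field point set set" where
  "one_bar_planes = {S \<in> Planes. S \<notin> Gamma_planes \<and> card (S \<inter> TC) = 1}"

definition T_points :: "'a::field point set" where
  "T_points = {P \<in> Points. P \<notin> TC \<and> (\<exists>t. P \<in> tangent t)}"

definition muGamma_points :: "nat \<Rightarrow> 'a::field point set" where
  "muGamma_points \<mu> = {P \<in> Points. P \<notin> TC \<and> (\<forall>t. P \<notin> tangent t)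
                        \<and> card {t. P \<in> osc t} = \<mu>}"

end

theory Submission
  imports Defs
begin

text \<open>
  For \<open>q = 4\<close> the twisted cubic is a frame of five points: the standard vectors \<open>frame t\<close> sum to zero
  and any four of them are a basis. An element of \<open>Gq\<close> therefore permutes them up to one common
  scalar. With the bilinear form \<open>B(x, y) = x0 y3 + x1 y2 + x2 y1 + x3 y0\<close> a vector \<open>x\<close> is determined by the
  five values \<open>ev x t = B(x, frame t)\<close>, which sum to zero and are permuted by \<open>Gq\<close> up to a scalar.

  Since the field has only four elements, two of the five values agree; call them \<open>d\<close>. The other three,
  \<open>a, b, c\<close>, sum to zero. With \<open>w\<close> a primitive cube root of unity, up to scalars and order this leaves for
  \<open>(a, b, c, d)\<close> the templates \<open>(0,1,1,1)\<close>, \<open>(1,w,w+1,0)\<close>, \<open>(0,0,0,1)\<close>, \<open>(0,1,1,w)\<close>, \<open>(w,w+1,1,1)\<close>, which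
  describe the points of the cubic, the T-points and the points on 3, 1 and 0 osculating planes. A
  template is located by an ordered triple of points of the cubic, so each class is an orbit
  of \<open>Gq_star\<close>, which is 3-transitive on the cubic. The polarity of \<open>B\<close> carries points to planes.
\<close>

section \<open>Vectors, points and planes in coordinates\<close>

lemma vec4_nth [simp]:
  "vec4 a b c d $ 1 = a" "vec4 a b c d $ 2 = b" "vec4 a b c d $ 3 = c" "vec4 a b c d $ 4 = d"
  by (simp_all add: vec4_def vector_def)

lemma vec4_eq_iff: "x = y \<longleftrightarrow> x $ 1 = y $ 1 \<and> x $ 2 = y $ 2 \<and> x $ 3 = y $ 3 \<and> x $ 4 = y $ 4"
  for x y :: "'a vec4"
  by (simp add: vec_eq_iff forall_4)

lemma dot4_eq: "dot4 c x = c $ 1 * x $ 1 + c $ 2 * x $ 2 + c $ 3 * x $ 3 + c $ 4 * x $ 4"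
  by (simp add: dot4_def sum_4)

lemma vector_matrix_mult_nth: "(x v* M) $ j = x $ 1 * M $ 1 $ j + x $ 2 * M $ 2 $ j + x $ 3 * M $ 3 $ j + x $ 4 * M $ 4 $ j"
  for M :: "'a::field mat4"
  by (simp add: vector_matrix_mult_def sum_4 mult.commute)

lemma vector_scalar_matrix: "(c *s x) v* M = c *s (x v* M)" for M :: "'a::field mat4"
  by (simp add: vec4_eq_iff vector_matrix_mult_nth algebra_simps)

lemma vector_sum_matrix: "(\<Sum>i\<in>A. f i) v* M = (\<Sum>i\<in>A. f i v* M)" for M :: "'a::field mat4"
  by (induction A rule: infinite_finite_induct)
     (simp_all add: vec4_eq_iff vector_matrix_mult_nth algebra_simps)

lemma mem_pt_self: "x \<in> pt x"
  by (auto simp: pt_def intro!: exI[of _ 1])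

lemma pt_scale: "c \<noteq> 0 \<Longrightarrow> pt (c *s x) = pt x"
proof -
  assume c: "c \<noteq> 0"
  have "d *s x = (d / c) *s (c *s x)" for d using c by simp
  then have "d *s x \<in> pt (c *s x)" if "d \<noteq> 0" for d
    using that c unfolding pt_def by (intro CollectI exI[of _ "d / c"]) auto
  then show ?thesis using c
    by (fastforce simp: pt_def)
qed

lemma pt_eq_iff: "pt x = pt y \<longleftrightarrow> (\<exists>c. c \<noteq> 0 \<and> x = c *s y)"
proof
  assume "pt x = pt y"
  then have "x \<in> pt y" using mem_pt_self by blast
  then show "\<exists>c. c \<noteq> 0 \<and> x = c *s y" by (auto simp: pt_def)
qed (auto simp: pt_scale)

lemma pmap_pt: "pmap M (pt x) = pt (x v* M)"
proof -
  have "pmap M (pt x) = {(c *s x) v* M | c. c \<noteq> 0}" by (auto simp: pmap_def pt_def)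
  then show ?thesis by (simp add: vector_scalar_matrix pt_def)
qed

lemma dot4_scale: "dot4 (a *s c) x = a * dot4 c x" "dot4 c (a *s x) = a * dot4 c x"
  by (simp_all add: dot4_eq algebra_simps)

lemma pt_mem_plane: "x \<noteq> 0 \<Longrightarrow> pt x \<in> plane c \<longleftrightarrow> dot4 c x = 0"
  unfolding plane_def pt_eq_iff mem_Collect_eq by (metis dot4_scale(2) mult_eq_0_iff vector_smult_lid zero_neq_one)

lemma plane_scale: "a \<noteq> 0 \<Longrightarrow> plane (a *s c) = plane c"
  by (auto simp: plane_def dot4_scale)

lemma plane_eqD:
  assumes "plane c = plane d" "c \<noteq> 0" "d \<noteq> 0"
  shows "\<exists>a. a \<noteq> 0 \<and> c = a *s d"
proof -
  obtain k where k: "d $ k \<noteq> 0" using assms(3) by (auto simp: vec_eq_iff)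
  have "c $ j * d $ k = c $ k * d $ j" for j
  proof (cases "j = k")
    case False
    \<comment> \<open>\<open>x\<close> is supported on the coordinates \<open>j\<close> and
      \<open>k\<close> and orthogonal to \<open>d\<close>. Orthogonality to \<open>c\<close> is then
      the vanishing of a 2x2 minor of \<open>c\<close> and \<open>d\<close>.\<close>
    define x where "x = d $ k *s axis j 1 - d $ j *s axis k 1"
    have dot: "dot4 e x = e $ j * d $ k - e $ k * d $ j" for e
    proof -
      have "dot4 e x = (\<Sum>i\<in>UNIV. (if i = j then e $ i * d $ k else 0) - (if i = k then e $ i * d $ j else 0))"
        unfolding dot4_def x_def by (intro sum.cong) (auto simp: axis_def algebra_simps)
      then show ?thesis by (simp add: sum_subtractf)
    qed
    have "x $ j = d $ k" using False by (simp add: x_def axis_def)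
    then have "x \<noteq> 0" using k by auto
    moreover have "dot4 d x = 0" by (simp add: dot)
    ultimately have "dot4 c x = 0" using assms(1) pt_mem_plane by blast
    then show ?thesis by (simp add: dot)
  qed simp
  then have "c = (c $ k / d $ k) *s d" using k by (simp add: vec_eq_iff field_simps)
  moreover from this have "c $ k / d $ k \<noteq> 0" using assms(2) by auto
  ultimately show ?thesis by blast
qed

section \<open>The frame vectors and the evaluation of binary cubic forms\<close>

fun frame :: "'a::field option \<Rightarrow> 'a vec4" where
  "frame None = vec4 1 0 0 0"
| "frame (Some t) = vec4 (t^3) (t^2) t 1"

text \<open>The binary cubic form with coefficients \<open>x\<close>, evaluated at a point of the projective line.\<close>

fun ev :: "'a::field vec4 \<Rightarrow> 'a option \<Rightarrow> 'a" where
  "ev x None = x $ 4"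
| "ev x (Some t) = x $ 1 + x $ 2 * t + x $ 3 * t^2 + x $ 4 * t^3"

text \<open>The antidiagonal Gram matrix of \<open>B\<close>: the value
  \<open>dot4 (rev4 x) y\<close> is \<open>B(x, y)\<close>.\<close>

definition rev4 :: "'a::field vec4 \<Rightarrow> 'a vec4" where
  "rev4 x = vec4 (x $ 4) (x $ 3) (x $ 2) (x $ 1)"

lemma rev4_rev4 [simp]: "rev4 (rev4 x) = x"
  by (simp add: rev4_def vec4_eq_iff)

lemma rev4_scale: "rev4 (a *s x) = a *s rev4 x"
  by (simp add: rev4_def vec4_eq_iff)

lemma rev4_eq_0 [simp]: "rev4 x = 0 \<longleftrightarrow> x = 0"
  by (auto simp: rev4_def vec4_eq_iff)

lemma dot4_rev4_frame: "dot4 (rev4 x) (frame t) = ev x t"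
  by (cases t) (simp_all add: dot4_eq rev4_def algebra_simps)

lemma dot4_rev4_commute: "dot4 (rev4 x) y = dot4 (rev4 y) x"
  by (simp add: dot4_eq rev4_def algebra_simps)

lemma Pc_eq: "Pc t = pt (frame t)"
  by (cases t) simp_all

lemma frame_nonzero [simp]: "frame t \<noteq> 0"
  by (cases t) (simp_all add: vec4_eq_iff)

lemma inj_Pc: "inj Pc"
proof (rule injI)
  fix s t :: "'a option"
  assume "Pc s = Pc t"
  then show "s = t"
    by (cases s; cases t) (auto simp: pt_eq_iff vec4_eq_iff)
qed

lemma TC_subset_Points: "TC \<subseteq> Points"
  by (auto simp: TC_def Points_def Pc_eq)

lemma ev_add: "ev (x + y) t = ev x t + ev y t"
  by (cases t) (simp_all add: algebra_simps)

lemma ev_scale: "ev (a *s x) t = a * ev x t"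
  by (cases t) (simp_all add: algebra_simps)

lemma ev_sum: "ev (\<Sum>i\<in>A. f i) t = (\<Sum>i\<in>A. ev (f i) t)"
proof (induction A rule: infinite_finite_induct)
  case (insert x F)
  then show ?case by (simp add: ev_add)
qed (cases t; simp)+

section \<open>Arithmetic and frame coordinates over the field of four elements\<close>

locale quaternary_field =
  fixes w :: "'a::field"
  assumes elems: "UNIV = {0, 1, w, w + 1}"
    and w_sq: "w * w = w + 1"
    and two_eq_0: "1 + 1 = (0::'a)"
begin

lemma double [simp]: "x + x = 0" for x :: 'a
  using two_eq_0 by (metis mult_2 one_add_one mult_zero_left)

lemma double_left [simp]: "x + (x + y) = y" for x y :: 'a
  by (simp flip: add.assoc)

lemma minus_eq [simp]: "- x = x" for x :: 'a
  by (metis add_eq_0_iff double)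

lemma diff_eq [simp]: "x - y = x + y" for x y :: 'a
  by (metis diff_conv_add_uminus minus_eq)

lemma two_mult [simp]: "2 * x = 0" for x :: 'a
  by (metis double mult_2)

lemma two_zero [simp]: "2 = (0::'a)"
  by (metis two_eq_0 one_add_one)

lemma three_one [simp]: "3 = (1::'a)"
  by (metis add_0 numeral_Bit1 numeral_One one_add_one two_eq_0)

lemma w_sq_left: "w * (w * x) = w * x + x"
  by (simp add: w_sq distrib_right flip: mult.assoc)

lemma w_distinct [simp]: "w \<noteq> 0" "w \<noteq> 1" "0 \<noteq> w" "1 \<noteq> w" "w + 1 \<noteq> 0" "1 + w \<noteq> 0" "w + 1 \<noteq> w"
  "w + 1 \<noteq> 1" "w \<noteq> w + 1" "1 \<noteq> w + 1" "0 \<noteq> w + 1"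
proof -
  show w0: "w \<noteq> 0" using w_sq by auto
  show w1: "w \<noteq> 1" using w_sq by auto
  show "0 \<noteq> w" "1 \<noteq> w" using w0 w1 by auto
  show "w + 1 \<noteq> 0" using w_sq w0 by (metis mult_eq_0_iff)
  then show "1 + w \<noteq> 0" "0 \<noteq> w + 1" by (auto simp: add.commute)
  show "w + 1 \<noteq> w" "w + 1 \<noteq> 1" "w \<noteq> w + 1" "1 \<noteq> w + 1" using w0 by simp_all
qed

lemma elem_cases [case_names zero one w w1]:
  obtains "x = 0" | "x = 1" | "x = w" | "x = w + 1"
  using elems by blast

lemmas arith_simps = w_sq w_sq_left power2_eq_square power3_eq_cube algebra_simps

lemma cube_nonzero: "x \<noteq> 0 \<Longrightarrow> x ^ 3 = 1" for x :: 'a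
  by (cases x rule: elem_cases) (simp_all add: arith_simps)

lemma add_eq_0_iff_eq [simp]: "x + y = 0 \<longleftrightarrow> x = y" for x y :: 'a
  by (metis double add_left_cancel)

lemma UNIV_option: "UNIV = {None, Some 0, Some 1, Some w, Some (w + 1)}"
proof -
  have "range Some = Some ` {0, 1, w, w + 1}" by (simp only: elems)
  then show ?thesis unfolding UNIV_option_conv by simp
qed

lemma finite_elems [simp]: "finite (A :: 'a set)"
  using elems by (metis finite.intros finite_subset subset_UNIV)

lemma finite_option [simp]: "finite (A :: 'a option set)"
  using UNIV_option by (metis finite.intros finite_subset subset_UNIV)

lemma card_elems: "CARD('a) = 4"
  unfolding elems by simp

lemma card_option: "CARD('a option) = 5"
  unfolding UNIV_option by simp

lemma sum_option: "(\<Sum>t\<in>UNIV. f t) = f None + f (Some 0) + f (Some 1) + f (Some w) + f (Some (w + 1))"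
  for f :: "'a option \<Rightarrow> 'b::comm_monoid_add"
  unfolding UNIV_option by (simp add: add.assoc)

text \<open>Since 3 = 1 in characteristic 2, the form attached to \<open>Some a\<close> takes the
  value (a + b)^3 at \<open>Some b\<close>, and every nonzero cube is 1.\<close>

lemma ev_frame: "ev (frame s) t = of_bool (t \<noteq> s)" for s t :: "'a option"
proof (cases s)
  case None
  then show ?thesis by (cases t) simp_all
next
  case (Some a)
  show ?thesis
  proof (cases t)
    case None
    then show ?thesis using Some by simp
  next
    case (Some b)
    have "ev (frame s) t = (a + b) ^ 3"
      using Some \<open>s = Some a\<close> by (simp add: arith_simps)
    then show ?thesis using Some \<open>s = Some a\<close> by (auto simp: cube_nonzero)
  qed
qed

text \<open>Over the four field elements the sums of 1, t and t^2 vanish and the sum of t^3 is 3 =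
  1. What remains, \<open>x $ 4\<close>, cancels against the value at infinity.\<close>

lemma sum_ev: "(\<Sum>t\<in>UNIV. ev x t) = 0" for x :: "'a vec4"
  by (simp add: sum_option arith_simps)

text \<open>By \<open>ev_frame\<close> the value at \<open>s\<close> omits only the summand
  \<open>g s\<close>. As the total is zero and signs do not matter, \<open>g s\<close> itself is
  left.\<close>

lemma ev_frame_comb:
  fixes g :: "'a option \<Rightarrow> 'a"
  assumes "(\<Sum>t\<in>UNIV. g t) = 0"
  shows "ev (\<Sum>t\<in>UNIV. g t *s frame t) s = g s"
proof -
  have "ev (\<Sum>t\<in>UNIV. g t *s frame t) s = (\<Sum>t\<in>UNIV. g t * of_bool (s \<noteq> t))"
    by (simp add: ev_sum ev_scale ev_frame)
  also have "\<dots> = (\<Sum>t\<in>UNIV - {s}. g t)"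
    by (rule sum.mono_neutral_cong_right) auto
  also have "\<dots> = (\<Sum>t\<in>UNIV. g t) - g s"
    by (simp add: sum_diff1)
  finally show ?thesis using assms by simp
qed

text \<open>Interpolation: the values at infinity and 0 give the outer coefficients, and those at 1
  and \<open>w\<close> give an invertible 2x2 system for the inner ones.\<close>

lemma ev_eqI:
  fixes x y :: "'a vec4"
  assumes "\<And>t. ev x t = ev y t"
  shows "x = y"
proof -
  have x4: "x $ 4 = y $ 4" using assms[of None] by simp
  have x1: "x $ 1 = y $ 1" using assms[of "Some 0"] by simp
  have x2: "x $ 2 + x $ 3 = y $ 2 + y $ 3" using assms[of "Some 1"] x4 x1 by (simp add: add.assoc)
  have "x $ 2 * w + x $ 3 * w^2 = y $ 2 * w + y $ 3 * w^2"
    using assms[of "Some w"] x4 x1 by (simp add: add.assoc)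
  then have "w * (x $ 2 + x $ 3) + x $ 3 = w * (y $ 2 + y $ 3) + y $ 3"
    by (simp add: arith_simps)
  then have x3: "x $ 3 = y $ 3" using x2 by simp
  show ?thesis using x1 x2 x3 x4 by (simp add: vec4_eq_iff)
qed

lemma ev_eq_iff: "x = y \<longleftrightarrow> (\<forall>t. ev x t = ev y t)" for x y :: "'a vec4"
  using ev_eqI by blast

lemma ev_0 [simp]: "ev 0 t = 0"
  by (cases t) simp_all

text \<open>The values of a vector are also its coordinates in the frame. The relation among the
  frame vectors makes such coordinates ambiguous; the values are a choice with sum zero.\<close>

lemma frame_expansion: "x = (\<Sum>t\<in>UNIV. ev x t *s frame t)" for x :: "'a vec4"
  by (rule ev_eqI) (simp only: ev_frame_comb sum_ev)

text \<open>In these coordinates \<open>B\<close> is the ordinary dot product, so permuting the five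
  values and scaling them by a common factor preserves orthogonality.\<close>

lemma dot4_rev4: "dot4 (rev4 x) y = (\<Sum>t\<in>UNIV. ev x t * ev y t)" for x y :: "'a vec4"
proof -
  have "dot4 (rev4 y) (\<Sum>t\<in>A. f t) = (\<Sum>t\<in>A. dot4 (rev4 y) (f t))" for A and f :: "'a option \<Rightarrow> 'a vec4"
    by (simp add: dot4_def sum_distrib_left sum.swap[of _ A])
  then have "dot4 (rev4 y) x = (\<Sum>t\<in>UNIV. ev x t * ev y t)"
    by (subst frame_expansion[of x]) (simp add: dot4_scale dot4_rev4_frame)
  then show ?thesis by (simp add: dot4_rev4_commute)
qed

lemma pt_eq_iff_ev: "pt x = pt y \<longleftrightarrow> (\<exists>c. c \<noteq> 0 \<and> (\<forall>t. ev x t = c * ev y t))" for x y :: "'a vec4"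
  by (simp add: pt_eq_iff ev_eq_iff ev_scale)

end

text \<open>Multiplication by a nonzero x permutes the three nonzero elements; comparing products
  gives x^3 = 1. Taking x = -1 yields characteristic 2, and any element other than 0 and 1 is a root
  of (X^3 - 1)/(X - 1).\<close>

lemma quaternary_field_exists:
  assumes "CARD('a::field) = 4"
  shows "\<exists>w :: 'a. quaternary_field w"
proof -
  have fin: "finite (UNIV :: 'a set)" using assms by (metis card.infinite zero_neq_numeral)
  have card: "card (UNIV - {0 :: 'a}) = 3" using assms fin by (simp add: card_Diff_singleton)
  have cube: "x ^ 3 = 1" if x: "x \<noteq> 0" for x :: 'a
  proof -
    have "bij_betw ((*) x) (UNIV - {0}) (UNIV - {0})"
      by (rule bij_betwI[where g = "(*) (inverse x)"]) (use x in auto)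
    then have "(\<Prod>y\<in>UNIV - {0}. x * y) = (\<Prod>y\<in>UNIV - {0}. y)"
      by (rule prod.reindex_bij_betw)
    then have "x ^ 3 * (\<Prod>y\<in>UNIV - {0}. y) = (\<Prod>y\<in>UNIV - {0}. y)"
      by (simp add: prod.distrib card)
    moreover have "(\<Prod>y\<in>UNIV - {0::'a}. y) \<noteq> 0" using fin by simp
    ultimately show ?thesis by simp
  qed
  have "(- 1 :: 'a) ^ 3 = 1" by (rule cube) simp
  then have two: "1 + 1 = (0::'a)" by (simp add: power3_eq_cube eq_neg_iff_add_eq_0[symmetric])
  have "UNIV \<noteq> {0, 1 :: 'a}"
  proof
    assume "UNIV = {0, 1 :: 'a}"
    then have "CARD('a) = card {0, 1 :: 'a}" by simp
    then show False using assms by simp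
  qed
  then obtain w :: 'a where w: "w \<noteq> 0" "w \<noteq> 1" by auto
  have "(w - 1) * (w * w + w + 1) = w ^ 3 - 1" by (simp add: power3_eq_cube algebra_simps)
  then have w2: "w * w + w + 1 = 0" using w cube[of w] by simp
  have dbl: "x + x = 0" for x :: 'a using two by (metis mult_2 one_add_one mult_zero_left)
  have w_sq: "w * w = w + 1"
    using w2 dbl[of "w + 1"] by (metis add.assoc add_right_cancel)
  have "w + 1 \<noteq> 0" using w_sq w(1) by (metis mult_eq_0_iff)
  then have "card {0, 1, w, w + 1} = 4" using w by auto
  then have "{0, 1, w, w + 1} = UNIV" using assms fin by (metis card_subset_eq subset_UNIV)
  then have "quaternary_field w" by unfold_locales (use w_sq two in auto)
  then show ?thesis by blast
qed

subsection \<open>The groups of the twisted cubic\<close>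

text \<open>The curve in homogeneous coordinates, which treats infinity like every other
  parameter.\<close>

definition cubic :: "'a::field \<Rightarrow> 'a \<Rightarrow> 'a vec4" where
  "cubic u v = vec4 (u^3) (u^2 * v) (u * v^2) (v^3)"

lemma Mabcd_nth:
  "Mabcd a b c d $ 1 = vec4 (a^3) (a^2*c) (a*c^2) (c^3)"
  "Mabcd a b c d $ 2 = vec4 (3*a^2*b) (a^2*d + 2*a*b*c) (b*c^2 + 2*a*c*d) (3*c^2*d)"
  "Mabcd a b c d $ 3 = vec4 (3*a*b^2) (b^2*c + 2*a*b*d) (a*d^2 + 2*b*c*d) (3*c*d^2)"
  "Mabcd a b c d $ 4 = vec4 (b^3) (b^2*d) (b*d^2) (d^3)"
  by (simp_all add: Mabcd_def vector_def)

text \<open>\<open>Mabcd\<close> is the third symmetric power of a linear substitution: its columns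
  hold the coefficients of the cubic monomials in a*u + b*v and c*u + d*v.\<close>

lemma cubic_Mabcd: "cubic u v v* Mabcd a b c d = cubic (a * u + b * v) (c * u + d * v)"
  by (simp add: vec4_eq_iff vector_matrix_mult_nth Mabcd_nth cubic_def power2_eq_square power3_eq_cube algebra_simps)

lemma cubic_scale: "cubic (r * u) (r * v) = r ^ 3 *s cubic u v"
  by (simp add: cubic_def vec4_eq_iff power_mult_distrib power2_eq_square power3_eq_cube)

text \<open>Composing a substitution with its adjugate is scaling by the determinant, whose third
  symmetric power is scaling by the cube of the determinant.\<close>

lemma Mabcd_adjugate: "Mabcd a b c d ** Mabcd d (- b) (- c) a = (\<chi> i. (a * d - b * c) ^ 3 *s (mat 1 $ i))"
  by (simp add: vec_eq_iff forall_4 matrix_matrix_mult_def sum_4 Mabcd_nth mat_def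
      power2_eq_square power3_eq_cube algebra_simps)

lemma invertible_Mabcd:
  assumes "a * d - b * c \<noteq> 0"
  shows "invertible (Mabcd a b c d)"
proof -
  let ?D = "(a * d - b * c) ^ 3"
  have "Mabcd a b c d ** (\<chi> i. inverse ?D *s (Mabcd d (- b) (- c) a $ i)) = mat 1"
  proof -
    have "(Mabcd a b c d ** (\<chi> i. inverse ?D *s (Mabcd d (- b) (- c) a $ i))) $ i $ j
        = inverse ?D * (Mabcd a b c d ** Mabcd d (- b) (- c) a) $ i $ j" for i j
      by (simp add: matrix_matrix_mult_def sum_distrib_left mult_ac)
    then show ?thesis unfolding Mabcd_adjugate using assms by (simp add: vec_eq_iff)
  qed
  then show ?thesis using invertible_right_inverse by blast
qed

fun hx :: "'a::field option \<Rightarrow> 'a" where "hx None = 1" | "hx (Some t) = t"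
fun hy :: "'a::field option \<Rightarrow> 'a" where "hy None = 0" | "hy (Some t) = 1"

lemma frame_eq_cubic: "frame t = cubic (hx t) (hy t)"
  by (cases t) (simp_all add: cubic_def vec4_eq_iff)

lemma mem_TC_iff: "P \<in> TC \<longleftrightarrow> (\<exists>t. P = pt (frame t))"
  by (auto simp: TC_def Pc_eq image_iff)

lemma homogeneous_coords:
  assumes "u \<noteq> 0 \<or> v \<noteq> 0"
  obtains t c where "c \<noteq> 0" "u = c * hx t" "v = c * hy t"
proof (cases "v = 0")
  case True
  then show ?thesis using that[of u None] assms by simp
next
  case False
  then show ?thesis using that[of v "Some (u / v)"] by simp
qed

lemma homogeneous_nonzero: "hx t \<noteq> 0 \<or> hy t \<noteq> 0"
  by (cases t) simp_all

lemma pt_cubic_mem_TC: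
  assumes "u \<noteq> 0 \<or> v \<noteq> 0"
  shows "pt (cubic u v) \<in> TC"
proof -
  obtain t c where "c \<noteq> 0" "u = c * hx t" "v = c * hy t"
    using homogeneous_coords[OF assms] .
  then have "pt (cubic u v) = Pc t"
    by (simp add: cubic_scale pt_scale Pc_eq frame_eq_cubic)
  then show ?thesis by (simp add: TC_def)
qed

lemma Gq_star_subset_Gq: "(Gq_star :: 'a::field mat4 set) \<subseteq> Gq"
proof
  fix M :: "'a mat4"
  assume "M \<in> Gq_star"
  then obtain a b c d where M: "M = Mabcd a b c d" and det: "a * d - b * c \<noteq> 0"
    by (auto simp: Gq_star_def)
  have nz: "a * u + b * v \<noteq> 0 \<or> c * u + d * v \<noteq> 0" if "u \<noteq> 0 \<or> v \<noteq> 0" for u v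
  proof (rule ccontr)
    assume "\<not> ?thesis"
    then have *: "a * u + b * v = 0" "c * u + d * v = 0" by auto
    have "(a * d - b * c) * u = d * (a * u + b * v) - b * (c * u + d * v)"
      "(a * d - b * c) * v = a * (c * u + d * v) - c * (a * u + b * v)"
      by (simp_all add: algebra_simps)
    then show False using * det that by simp
  qed
  have "pmap M P \<in> TC" if mem: "P \<in> TC" for P
  proof -
    obtain t where "P = pt (cubic (hx t) (hy t))"
      using mem unfolding mem_TC_iff frame_eq_cubic by blast
    then have "pmap M P = pt (cubic (a * hx t + b * hy t) (c * hx t + d * hy t))"
      by (simp add: pmap_pt M cubic_Mabcd)
    then show ?thesis using pt_cubic_mem_TC[OF nz[OF homogeneous_nonzero]] by metis
  qed
  moreover have "P \<in> pmap M ` TC" if mem: "P \<in> TC" for P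
  proof -
    obtain t where P: "P = pt (cubic (hx t) (hy t))"
      using mem unfolding mem_TC_iff frame_eq_cubic by blast
    \<comment> \<open>The adjugate substitution applied to \<open>t\<close>: it gives a preimage up
      to the factor a*d - b*c, without division.\<close>
    define u v where "u = d * hx t - b * hy t" and "v = a * hy t - c * hx t"
    have uv: "a * u + b * v = (a * d - b * c) * hx t" "c * u + d * v = (a * d - b * c) * hy t"
      by (simp_all add: u_def v_def algebra_simps)
    then have "u \<noteq> 0 \<or> v \<noteq> 0"
      using det homogeneous_nonzero[of t] by fastforce
    moreover have "pmap M (pt (cubic u v)) = P"
      using det by (simp add: pmap_pt M cubic_Mabcd uv cubic_scale pt_scale P)
    ultimately show ?thesis using pt_cubic_mem_TC by blast
  qed
  ultimately have "pmap M ` TC = TC" by blast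
  then show "M \<in> Gq" using invertible_Mabcd[OF det] by (simp add: Gq_def M)
qed

text \<open>The 2x2 determinant of two points of the projective line, the building block for an
  explicit substitution with prescribed images.\<close>

definition bracket :: "'a::field option \<Rightarrow> 'a option \<Rightarrow> 'a" where
  "bracket s t = hx s * hy t - hx t * hy s"

lemma bracket_eq_0_iff: "bracket s t = 0 \<longleftrightarrow> s = t"
  by (cases s; cases t) (auto simp: bracket_def)

lemma bracket_self [simp]: "bracket s s = 0"
  by (simp add: bracket_def)

lemma Gq_star_3_transitive:
  fixes i j k i' j' k' :: "'a::field option"
  assumes "distinct [i, j, k]" "distinct [i', j', k']"
  shows "\<exists>M\<in>Gq_star. pmap M (Pc i) = Pc i' \<and> pmap M (Pc j) = Pc j' \<and> pmap M (Pc k) = Pc k'"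
proof -
  \<comment> \<open>For any nonzero \<kappa> and \<mu> the substitution below takes \<open>i\<close>
    to \<open>i'\<close> and \<open>j\<close> to \<open>j'\<close>. These two factors are chosen so
    that \<open>k\<close> goes to \<open>k'\<close>.\<close>
  define \<kappa> where "\<kappa> = bracket k' j' * bracket i k"
  define \<mu> where "\<mu> = bracket i' k' * bracket k j"
  have nz: "\<kappa> \<noteq> 0" "\<mu> \<noteq> 0" "bracket i j \<noteq> 0" "bracket i' j' \<noteq> 0" "bracket i k \<noteq> 0" "bracket k j \<noteq> 0"
    using assms by (auto simp: \<kappa>_def \<mu>_def bracket_eq_0_iff)
  define a b c d where
    "a = hy j * \<kappa> * hx i' - hy i * \<mu> * hx j'"
    and "b = hx i * \<mu> * hx j' - hx j * \<kappa> * hx i'"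
    and "c = hy j * \<kappa> * hy i' - hy i * \<mu> * hy j'"
    and "d = hx i * \<mu> * hy j' - hx j * \<kappa> * hy i'"
  have det: "a * d - b * c = bracket i j * \<kappa> * \<mu> * bracket i' j'"
    by (simp add: a_def b_def c_def d_def bracket_def algebra_simps)
  have act: "a * hx t + b * hy t = bracket t j * \<kappa> * hx i' + bracket i t * \<mu> * hx j'"
    "c * hx t + d * hy t = bracket t j * \<kappa> * hy i' + bracket i t * \<mu> * hy j'" for t
    by (simp_all add: a_def b_def c_def d_def bracket_def algebra_simps)
  have pm: "pmap (Mabcd a b c d) (Pc t) = Pc t'"
    if "a * hx t + b * hy t = r * hx t'" "c * hx t + d * hy t = r * hy t'" "r \<noteq> 0" for t t' r
    using that by (simp add: Pc_eq frame_eq_cubic pmap_pt cubic_Mabcd cubic_scale pt_scale)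
  have "pmap (Mabcd a b c d) (Pc i) = Pc i'"
    by (rule pm[where r = "bracket i j * \<kappa>"]) (use nz in \<open>simp_all add: act\<close>)
  moreover have "pmap (Mabcd a b c d) (Pc j) = Pc j'"
    by (rule pm[where r = "bracket i j * \<mu>"]) (use nz in \<open>simp_all add: act\<close>)
  moreover have "pmap (Mabcd a b c d) (Pc k) = Pc k'"
  \<comment> \<open>This is the linear relation [k' j'] i' + [i' k'] j' = [i' j'] k' between three
    vectors of the plane, multiplied by [k j] [i k].\<close>
  proof (rule pm[where r = "bracket k j * bracket i k * bracket i' j'"])
    show "bracket k j * bracket i k * bracket i' j' \<noteq> 0" using nz by simp
  qed (simp_all only: act \<kappa>_def \<mu>_def bracket_def, simp_all add: algebra_simps)
  moreover have "Mabcd a b c d \<in> Gq_star"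
    using det nz unfolding Gq_star_def mem_Collect_eq by (metis mult_eq_0_iff)
  ultimately show ?thesis by blast
qed

section \<open>The action of \<open>Gq\<close> on the frame\<close>

context quaternary_field
begin

lemma sum_frame: "(\<Sum>t\<in>UNIV. frame t) = (0 :: 'a vec4)"
  by (simp add: sum_option vec4_eq_iff arith_simps)

lemma sum_of_bool_neq: "(\<Sum>t\<in>UNIV. g t * of_bool (s \<noteq> t)) = (\<Sum>t\<in>UNIV. g t) + g s"
  for g :: "'a option \<Rightarrow> 'a"
proof -
  have "(\<Sum>t\<in>UNIV. g t * of_bool (s \<noteq> t)) = (\<Sum>t\<in>UNIV - {s}. g t)"
    by (rule sum.mono_neutral_cong_right) auto
  then show ?thesis by (simp add: sum_diff1)
qed

text \<open>Preserving the cubic gives one scalar for each frame vector. The scalars coincide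
  because the linear relation among the five frame vectors is unique up to a factor.\<close>

lemma Gq_permutes_frame:
  fixes M :: "'a mat4"
  assumes "M \<in> Gq"
  obtains \<sigma> l where "bij \<sigma>" "l \<noteq> 0" "\<And>t. frame t v* M = l *s frame (\<sigma> t)"
proof -
  have TC: "pmap M ` TC = TC" using assms by (simp add: Gq_def)
  have "\<exists>s c. c \<noteq> 0 \<and> frame t v* M = c *s frame s" for t
  proof -
    have "pmap M (Pc t) \<in> TC" using TC unfolding TC_def by blast
    then show ?thesis by (auto simp: mem_TC_iff Pc_eq pmap_pt pt_eq_iff)
  qed
  then obtain \<sigma> l where l: "\<And>t. l t \<noteq> 0" "\<And>t. frame t v* M = l t *s frame (\<sigma> t)"
    by metis
  have "\<exists>t. s = \<sigma> t" for s
  proof -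
    have "Pc s \<in> pmap M ` TC" using TC by (simp add: TC_def)
    then obtain t where "Pc s = pmap M (Pc t)" by (auto simp: TC_def)
    then have "Pc s = Pc (\<sigma> t)" by (simp add: Pc_eq pmap_pt l pt_scale)
    then show ?thesis using inj_Pc by (auto dest: injD)
  qed
  then have surj: "surj \<sigma>" by auto
  then have inj: "inj \<sigma>" by (intro finite_UNIV_surj_inj) simp_all
  \<comment> \<open>Apply \<open>M\<close> to the relation \<open>sum_frame\<close>. The value of
    the result at \<open>\<sigma> s\<close> omits only \<open>l s\<close>, so \<open>l s\<close>
    equals the total, whatever \<open>s\<close> is.\<close>
  have "l s = (\<Sum>t\<in>UNIV. l t)" for s
  proof -
    have "(\<Sum>t\<in>UNIV. l t *s frame (\<sigma> t)) = (\<Sum>t\<in>UNIV. frame t) v* M"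
      by (simp only: vector_sum_matrix l(2))
    also have "\<dots> = 0" by (simp add: sum_frame)
    finally have "ev (\<Sum>t\<in>UNIV. l t *s frame (\<sigma> t)) (\<sigma> s) = 0" by simp
    then have "(\<Sum>t\<in>UNIV. l t * of_bool (s \<noteq> t)) = 0"
      by (simp add: ev_sum ev_scale ev_frame inj_eq[OF inj])
    then show ?thesis by (simp only: sum_of_bool_neq add_eq_0_iff_eq)
  qed
  then have "frame t v* M = l None *s frame (\<sigma> t)" for t using l(2) by metis
  moreover have "bij \<sigma>" using surj inj by (simp add: bij_def)
  ultimately show ?thesis using that l(1) by blast
qed

lemma ev_permuted:
  fixes x :: "'a vec4"
  assumes "bij \<sigma>" "\<And>t. frame t v* M = l *s frame (\<sigma> t)"
  shows "ev (x v* M) (\<sigma> s) = l * ev x s"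
proof -
  have "x v* M = (\<Sum>t\<in>UNIV. ev x t *s frame t) v* M" using frame_expansion[of x] by simp
  also have "\<dots> = (\<Sum>t\<in>UNIV. (ev x t * l) *s frame (\<sigma> t))"
    by (simp only: vector_sum_matrix vector_scalar_matrix assms(2) vector_smult_assoc)
  finally have "ev (x v* M) (\<sigma> s) = (\<Sum>t\<in>UNIV. ev x t * l * of_bool (s \<noteq> t))"
    using assms(1) by (simp add: ev_sum ev_scale ev_frame inj_eq[OF bij_is_inj])
  also have "\<dots> = (\<Sum>t\<in>UNIV. ev x t) * l + ev x s * l"
    by (simp only: sum_of_bool_neq sum_distrib_right)
  finally show ?thesis by (simp only: sum_ev) simp
qed

lemma vector_matrix_eq_0_iff:
  fixes x :: "'a vec4"
  assumes "M \<in> Gq"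
  shows "x v* M = 0 \<longleftrightarrow> x = 0"
proof -
  obtain \<sigma> l where \<sigma>: "bij \<sigma>" "l \<noteq> 0" "\<And>t. frame t v* M = l *s frame (\<sigma> t)"
    using Gq_permutes_frame[OF assms] by metis
  have "ev x t = 0" if "x v* M = 0" for t
    using ev_permuted[OF \<sigma>(1,3), of x t] that \<sigma>(2) by simp
  then have "x = 0" if "x v* M = 0" using that by (simp add: ev_eq_iff[of x])
  then show ?thesis by auto
qed

section \<open>Templates and their orbits\<close>

definition template :: "'a option \<Rightarrow> 'a option \<Rightarrow> 'a option \<Rightarrow> 'a \<Rightarrow> 'a \<Rightarrow> 'a \<Rightarrow> 'a \<Rightarrow> 'a option \<Rightarrow> 'a" where
  "template i j k a b c d t = (if t = i then a else if t = j then b else if t = k then c else d)"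

definition template_class :: "'a \<Rightarrow> 'a \<Rightarrow> 'a \<Rightarrow> 'a \<Rightarrow> 'a point set" where
  "template_class a b c d = {pt x | x i j k. distinct [i, j, k] \<and> x \<noteq> 0 \<and> ev x = template i j k a b c d}"

lemma template_class_subset_Points: "template_class a b c d \<subseteq> Points"
  by (auto simp: template_class_def Points_def)

lemma template_permuted: "bij \<sigma> \<Longrightarrow> template (\<sigma> i) (\<sigma> j) (\<sigma> k) a b c d (\<sigma> t) = template i j k a b c d t"
  by (simp add: template_def inj_eq[OF bij_is_inj])

lemma scale_eq_0: "c *s x = 0 \<longleftrightarrow> c = 0 \<or> x = 0" for c :: 'a and x :: "'a vec4"
  by (auto simp: vec4_eq_iff)

lemma pt_mem_template_classI:
  assumes "distinct [i, j, k]" "x \<noteq> 0" "r \<noteq> 0" "\<And>t. ev x t = r * template i j k a b c d t"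
  shows "pt x \<in> template_class a b c d"
proof -
  have "pt (inverse r *s x) \<in> template_class a b c d"
    unfolding template_class_def
    by (rule CollectI, rule exI[of _ "inverse r *s x"], intro exI[of _ i] exI[of _ j] exI[of _ k])
       (use assms in \<open>auto simp: scale_eq_0 ev_scale fun_eq_iff mult.assoc[symmetric]\<close>)
  then show ?thesis using assms(3) by (simp add: pt_scale)
qed

text \<open>\<open>Gq\<close> only moves the positions of a template and rescales it, so its orbit
  stays in the class. Conversely \<open>Gq_star\<close> moves the triple to any other; where the two
  remaining positions go is immaterial because both carry \<open>d\<close>. The orbit of
  \<open>Gq_star\<close> lies in that of \<open>Gq\<close>, which closes the chain.\<close>

lemma orbit_template_class:
  assumes "P \<in> template_class a b c d"
  shows "orbit_pt Gq P = template_class a b c d" "orbit_pt Gq_star P = template_class a b c d"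
proof -
  obtain x i j k where P: "P = pt x" and dist: "distinct [i, j, k]" and "x \<noteq> 0"
    and ev: "ev x = template i j k a b c d"
    using assms unfolding template_class_def by blast
  have "orbit_pt Gq P \<subseteq> template_class a b c d"
  proof
    fix Q assume "Q \<in> orbit_pt Gq P"
    then obtain M where M: "M \<in> Gq" and Q: "Q = pt (x v* M)"
      by (auto simp: orbit_pt_def P pmap_pt)
    obtain \<sigma> l where \<sigma>: "bij \<sigma>" "l \<noteq> 0" "\<And>t. frame t v* M = l *s frame (\<sigma> t)"
      using Gq_permutes_frame[OF M] by metis
    have "ev (x v* M) s = l * template (\<sigma> i) (\<sigma> j) (\<sigma> k) a b c d s" for s
    proof -
      obtain t where "s = \<sigma> t" using \<sigma>(1) by (metis bij_pointE)
      then show ?thesis by (simp only: ev_permuted[OF \<sigma>(1,3)] template_permuted[OF \<sigma>(1)] ev)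
    qed
    moreover have "distinct [\<sigma> i, \<sigma> j, \<sigma> k]" using dist \<sigma>(1) by (simp add: inj_eq[OF bij_is_inj])
    ultimately show "Q \<in> template_class a b c d"
      unfolding Q using \<sigma>(2) \<open>x \<noteq> 0\<close> by (intro pt_mem_template_classI) (simp_all add: vector_matrix_eq_0_iff M)
  qed
  moreover have "template_class a b c d \<subseteq> orbit_pt Gq_star P"
  proof
    fix Q assume "Q \<in> template_class a b c d"
    then obtain y i' j' k' where Q: "Q = pt y" and dist': "distinct [i', j', k']"
      and ev': "ev y = template i' j' k' a b c d"
      unfolding template_class_def by blast
    obtain M where M: "M \<in> Gq_star" and Pc: "pmap M (Pc i) = Pc i'" "pmap M (Pc j) = Pc j'" "pmap M (Pc k) = Pc k'"
      using Gq_star_3_transitive[OF dist dist'] by blast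
    have "M \<in> Gq" using M Gq_star_subset_Gq by blast
    then obtain \<sigma> l where \<sigma>: "bij \<sigma>" "l \<noteq> 0" "\<And>t. frame t v* M = l *s frame (\<sigma> t)"
      using Gq_permutes_frame by metis
    have "pmap M (Pc t) = Pc (\<sigma> t)" for t using \<sigma>(2,3) by (simp add: Pc_eq pmap_pt pt_scale)
    then have images: "\<sigma> i = i'" "\<sigma> j = j'" "\<sigma> k = k'" using Pc inj_Pc by (auto dest: injD)
    have "ev (x v* M) s = l * ev y s" for s
    proof -
      obtain t where "s = \<sigma> t" using \<sigma>(1) by (metis bij_pointE)
      then show ?thesis
        by (simp only: ev_permuted[OF \<sigma>(1,3)] ev ev' template_permuted[OF \<sigma>(1)] flip: images)
    qed
    then have "pmap M P = Q" using \<sigma>(2) by (auto simp: P Q pmap_pt pt_eq_iff_ev)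
    then show "Q \<in> orbit_pt Gq_star P" using M by (auto simp: orbit_pt_def)
  qed
  moreover have "orbit_pt Gq_star P \<subseteq> orbit_pt Gq P"
    using Gq_star_subset_Gq by (auto simp: orbit_pt_def)
  ultimately show "orbit_pt Gq P = template_class a b c d" "orbit_pt Gq_star P = template_class a b c d"
    by blast+
qed

subsection \<open>Classification of points\<close>

lemma five_points:
  assumes "distinct [i, j, k :: 'a option]"
  obtains l m where "distinct [i, j, k, l, m]" "UNIV = {i, j, k, l, m}"
proof -
  have "card (UNIV - {i, j, k}) = 2" using assms card_option by (simp add: card_Diff_subset)
  then obtain l m where lm: "UNIV - {i, j, k} = {l, m}" "l \<noteq> m" by (auto simp: card_2_iff)
  then have "distinct [i, j, k, l, m]" "UNIV = {i, j, k, l, m}" using assms by auto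
  then show ?thesis using that by blast
qed

text \<open>The value \<open>d\<close> occurs at two positions and cancels, so a + b + c = 0 makes
  the five values sum to zero.\<close>

lemma vec_with_values:
  assumes "distinct [i, j, k]" "a + b + c = 0"
  shows "ev (\<Sum>t\<in>UNIV. template i j k a b c d t *s frame t) = template i j k a b c d"
proof -
  obtain l m where lm: "distinct [i, j, k, l, m]" "UNIV = {i, j, k, l, m}"
    using five_points[OF assms(1)] .
  have "(\<Sum>t\<in>UNIV. template i j k a b c d t) = 0"
    unfolding lm(2) using lm(1) assms(2) by (auto simp: template_def simp flip: add.assoc simp del: add_eq_0_iff_eq)
  then show ?thesis by (simp add: ev_frame_comb fun_eq_iff)
qed

lemma nonzero_scalar: "r \<noteq> 0 \<longleftrightarrow> r = 1 \<or> r = w \<or> r = w + 1" for r :: 'a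
  by (cases r rule: elem_cases) auto

lemma w_mult [simp]: "w * (w + 1) = 1" "(w + 1) * w = 1" "(w + 1) * (w + 1) = w"
  by (simp_all add: arith_simps)

lemma template_class_of_zero_value:
  assumes "distinct [i, j, k, l, m]" "UNIV = {i, j, k, l, m}" "x \<noteq> 0"
    and "ev x i = 0" "ev x j = ev x k" "ev x l = ev x m"
  shows "pt x \<in> template_class 0 1 1 1 \<union> template_class 0 0 0 1 \<union> template_class 0 1 1 w"
proof -
  have all: "(\<forall>t. P t) \<longleftrightarrow> P i \<and> P j \<and> P k \<and> P l \<and> P m" for P
    using assms(2) by (metis UNIV_I empty_iff insert_iff)
  define b where "b = ev x j"
  define d where "d = ev x l"
  have vals: "ev x j = b" "ev x k = b" "ev x l = d" "ev x m = d" "ev x i = 0"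
    using assms by (simp_all add: b_def d_def)
  have nz: "b \<noteq> 0 \<or> d \<noteq> 0"
    using assms(3) vals by (auto simp: ev_eq_iff[of x] all)
  have I: "pt x \<in> template_class a1 a2 a3 a4"
    if "distinct [i', j', k']" "r \<noteq> 0" "\<forall>t. ev x t = r * template i' j' k' a1 a2 a3 a4 t" for a1 a2 a3 a4 i' j' k' r
    using pt_mem_template_classI[of i' j' k' x r] that assms(3) by blast
  \<comment> \<open>The values are 0, b, b, d, d, and the ratio of \<open>b\<close> to
    \<open>d\<close> decides the class. In the second and fifth cases the pairs \<open>j, k\<close>
    and \<open>l, m\<close> exchange roles.\<close>
  consider "b = 0" "d \<noteq> 0" | "d = 0" "b \<noteq> 0" | "b = d" "b \<noteq> 0" | "b \<noteq> 0" "d = b * w" | "d \<noteq> 0" "b = d * w"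
  proof -
    have "b = 0 \<or> d = 0 \<or> b = d \<or> d = b * w \<or> b = d * w"
      by (cases b rule: elem_cases; cases d rule: elem_cases) (simp_all add: w_sq)
    then show ?thesis using that nz by blast
  qed
  then show ?thesis
  proof cases
    case 1
    then show ?thesis using assms(1) by (intro UnI1 UnI2 I[of i j k d]) (auto simp: all vals template_def)
  next
    case 2
    then show ?thesis using assms(1) by (intro UnI1 UnI2 I[of i l m b]) (auto simp: all vals template_def)
  next
    case 3
    then show ?thesis using assms(1) by (intro UnI1 I[of i j k b]) (auto simp: all vals template_def)
  next
    case 4
    then show ?thesis using assms(1) by (intro UnI2 I[of i j k b]) (auto simp: all vals template_def)
  next
    case 5
    then show ?thesis using assms(1) by (intro UnI2 I[of i l m d]) (auto simp: all vals template_def)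
  qed
qed

text \<open>The values at \<open>i, j, k\<close> are the three nonzero elements, so the repeated
  value is zero or equals one of them. In the latter case dividing by it makes it 1, which rotates
  the triple cyclically.\<close>

lemma template_class_of_nonzero_values:
  assumes "distinct [i, j, k, l, m]" "UNIV = {i, j, k, l, m}" "x \<noteq> 0"
    and "a \<noteq> 0" "ev x i = a" "ev x j = a * w" "ev x k = a * (w + 1)" "ev x l = ev x m"
  shows "pt x \<in> template_class 1 w (w + 1) 0 \<union> template_class w (w + 1) 1 1"
proof -
  have all: "(\<forall>t. P t) \<longleftrightarrow> P i \<and> P j \<and> P k \<and> P l \<and> P m" for P
    using assms(2) by (metis UNIV_I empty_iff insert_iff)
  define d where "d = ev x l"
  have vals: "ev x i = a" "ev x j = a * w" "ev x k = a * (w + 1)" "ev x l = d" "ev x m = d"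
    using assms by (simp_all add: d_def)
  have I: "pt x \<in> template_class a1 a2 a3 a4"
    if "distinct [i', j', k']" "r \<noteq> 0" "\<forall>t. ev x t = r * template i' j' k' a1 a2 a3 a4 t" for a1 a2 a3 a4 i' j' k' r
    using pt_mem_template_classI[of i' j' k' x r] that assms(3) by blast
  consider "d = 0" | "d = a" | "d = a * w" | "d = a * (w + 1)"
    using assms(4) by (cases a rule: elem_cases; cases d rule: elem_cases) (auto simp: w_sq)
  then show ?thesis
  proof cases
    case 1
    then show ?thesis using assms(1,4) by (intro UnI1 I[of i j k a]) (auto simp: all vals template_def)
  next
    case 2
    then show ?thesis using assms(1,4) by (intro UnI2 I[of j k i d]) (auto simp: all vals template_def)
  next
    case 3
    then show ?thesis using assms(1,4) by (intro UnI2 I[of k i j d]) (auto simp: all vals template_def mult.assoc w_sq)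
  next
    case 4
    then show ?thesis using assms(1,4) by (intro UnI2 I[of i j k d]) (auto simp: all vals template_def mult.assoc)
  qed
qed

lemma Points_cases:
  assumes "P \<in> Points"
  shows "P \<in> template_class 0 1 1 1 \<union> template_class 0 0 0 1 \<union> template_class 0 1 1 w
    \<union> template_class 1 w (w + 1) 0 \<union> template_class w (w + 1) 1 1"
proof -
  obtain x where P: "P = pt x" and "x \<noteq> 0" using assms by (auto simp: Points_def)
  \<comment> \<open>Pigeonhole: five positions, four field elements.\<close>
  have "\<not> inj (ev x)"
  proof
    assume "inj (ev x)"
    then have "CARD('a option) \<le> CARD('a)" by (intro card_inj_on_le) auto
    then show False by (simp add: card_option card_elems)
  qed
  then obtain l m where lm: "l \<noteq> m" "ev x l = ev x m" by (auto simp: inj_def)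
  have "card (UNIV - {l, m}) = 3" using lm(1) card_option by (simp add: card_Diff_subset)
  then obtain i j k where ijk: "UNIV - {l, m} = {i, j, k}" "i \<noteq> j" "j \<noteq> k" "i \<noteq> k"
    unfolding card_3_iff by blast
  have UNIV: "UNIV = {i, j, k, l, m}" and dist: "distinct [i, j, k, l, m]" using ijk lm(1) by auto
  have "ev x i + ev x j + ev x k = 0"
    using sum_ev[of x] dist lm(2) unfolding UNIV by (simp add: add.assoc)
  then have sum: "ev x k = ev x i + ev x j" by (metis add_eq_0_iff_eq)
  have perm: "{j, i, k, l, m} = UNIV" "{k, i, j, l, m} = UNIV" "{i, k, j, l, m} = UNIV" using UNIV by auto
  \<comment> \<open>If none of three values with sum zero vanishes, no two agree, since the third
    would be zero. They are then all three nonzero elements, in one of the two cyclic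
    orders.\<close>
  consider "ev x i = 0" | "ev x j = 0" | "ev x k = 0"
    | "ev x i \<noteq> 0" "ev x j = ev x i * w" | "ev x i \<noteq> 0" "ev x k = ev x i * w"
    unfolding sum
    by (cases "ev x i" rule: elem_cases; cases "ev x j" rule: elem_cases) (auto simp: w_sq algebra_simps)
  then show ?thesis
  proof cases
    case 1
    then show ?thesis
      using template_class_of_zero_value[of i j k l m x] UNIV dist lm sum \<open>x \<noteq> 0\<close> by (auto simp: P)
  next
    case 2
    then show ?thesis
      using template_class_of_zero_value[of j i k l m x] perm dist lm sum \<open>x \<noteq> 0\<close> by (auto simp: P)
  next
    case 3
    then show ?thesis
      using template_class_of_zero_value[of k i j l m x] perm dist lm sum \<open>x \<noteq> 0\<close> by (auto simp: P)
  next
    case 4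
    then have "ev x k = ev x i * (w + 1)" using sum by (simp add: algebra_simps)
    then show ?thesis
      using template_class_of_nonzero_values[of i j k l m x] 4 UNIV dist lm \<open>x \<noteq> 0\<close> by (auto simp: P)
  next
    case 5
    have "ev x j = ev x i + ev x k" by (simp add: sum)
    then have "ev x j = ev x i * (w + 1)" using 5 by (simp add: algebra_simps)
    then show ?thesis
      using template_class_of_nonzero_values[of i k j l m x] 5 perm dist lm \<open>x \<noteq> 0\<close> by (auto simp: P)
  qed
qed

text \<open>Any triple serves to place the values; the vector is nonzero because
  \<open>Some w\<close> lies outside the chosen triple and carries \<open>d\<close>.\<close>

lemma template_class_nonempty:
  assumes "a + b + c = 0" "a \<noteq> 0 \<or> b \<noteq> 0 \<or> d \<noteq> 0"
  shows "template_class a b c d \<noteq> {}"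
proof -
  let ?x = "\<Sum>t\<in>UNIV. template None (Some 0) (Some 1) a b c d t *s frame t"
  have ev: "ev ?x = template None (Some 0) (Some 1) a b c d"
    using assms by (intro vec_with_values) simp_all
  have "?x \<noteq> 0"
  proof
    assume "?x = 0"
    then have "template None (Some 0) (Some 1) a b c d t = 0" for t using ev by (metis ev_0)
    from this[of None] this[of "Some 0"] this[of "Some w"] show False
      using assms(2) by (simp add: template_def)
  qed
  then have "pt ?x \<in> template_class a b c d"
    using ev unfolding template_class_def mem_Collect_eq
    by (intro exI[of _ ?x] exI[of _ None] exI[of _ "Some 0"] exI[of _ "Some 1"]) simp
  then show ?thesis by blast
qed

text \<open>In characteristic 2 the coefficients 1, -3t, 3t^2, -t^3 become 1, t, t^2, t^3, the
  reversed frame vector. Osculating planes through a point thus correspond to zeros of its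
  values.\<close>

lemma osc_eq_plane: "osc t = plane (rev4 (frame t))" for t :: "'a option"
  by (cases t) (simp_all add: rev4_def)

lemma pt_mem_osc: "x \<noteq> 0 \<Longrightarrow> pt x \<in> osc t \<longleftrightarrow> ev x t = 0" for x :: "'a vec4"
  by (simp add: osc_eq_plane pt_mem_plane dot4_rev4_commute[of "frame t"] dot4_rev4_frame)

lemma card_osc_template_class:
  assumes "P \<in> template_class a b c d"
  shows "card {t. P \<in> osc t} = of_bool (a = 0) + of_bool (b = 0) + of_bool (c = 0) + (if d = 0 then 2 else 0)"
proof -
  obtain x i j k where P: "P = pt x" and dist: "distinct [i, j, k]" and x: "x \<noteq> 0"
    and ev: "ev x = template i j k a b c d"
    using assms unfolding template_class_def by blast
  obtain l m where lm: "distinct [i, j, k, l, m]" "UNIV = {i, j, k, l, m}"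
    using five_points[OF dist] .
  have "card {t. P \<in> osc t} = (\<Sum>t\<in>UNIV. of_bool (template i j k a b c d t = 0))"
    by (simp add: P pt_mem_osc x ev)
  also have "\<dots> = of_bool (a = 0) + of_bool (b = 0) + of_bool (c = 0) + (if d = 0 then 2 else 0)"
    unfolding lm(2) using lm(1) by (auto simp: template_def)
  finally show ?thesis .
qed

section \<open>Sizes of the template classes\<close>

definition triples :: "('a option \<times> 'a option \<times> 'a option) set" where
  "triples = {(i, j, k). distinct [i, j, k]}"

lemma card_triples: "card triples = 60"
proof -
  have triples_eq: "triples = (SIGMA i:UNIV. SIGMA j:UNIV - {i}. UNIV - {i, j})"
    by (auto simp: triples_def)
  then have "card triples = (\<Sum>i\<in>UNIV. \<Sum>j\<in>UNIV - {i}. card (UNIV - {i, j :: 'a option}))"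
    unfolding triples_eq by (subst card_SigmaI; simp)+
  also have "\<dots> = (\<Sum>i\<in>(UNIV :: 'a option set). \<Sum>j\<in>UNIV - {i}. 3)"
    by (intro sum.cong) (auto simp: card_Diff_subset card_option)
  also have "\<dots> = 60"
    by (simp add: card_Diff_subset card_option)
  finally show ?thesis .
qed

text \<open>Double counting: the 60 ordered triples map onto the class with all fibres of size
  \<open>n\<close>. The fibres are expressed through proportional templates, so that they can be
  found by a finite check.\<close>

lemma card_template_class:
  assumes sum: "a + b + c = 0"
    and nz: "a \<noteq> 0 \<or> b \<noteq> 0 \<or> d \<noteq> 0"
    and fib: "\<And>i j k. distinct [i, j, k] \<Longrightarrow>
      card {(i', j', k') \<in> triples. \<exists>r. r \<noteq> 0 \<and> (\<forall>t. template i' j' k' a b c d t = r * template i j k a b c d t)} = n"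
  shows "n * card (template_class a b c d) = 60"
proof -
  define f where "f = (\<lambda>(i, j, k). pt (\<Sum>t\<in>UNIV. template i j k a b c d t *s frame t))"
  have f: "f ` triples = template_class a b c d"
  proof
    have "pt (\<Sum>t\<in>UNIV. template i j k a b c d t *s frame t) \<in> template_class a b c d"
      if dist: "distinct [i, j, k]" for i j k
    proof -
      let ?x = "\<Sum>t\<in>UNIV. template i j k a b c d t *s frame t"
      obtain l m where lm: "distinct [i, j, k, l, m]" using five_points[OF dist] by metis
      have ev: "ev ?x = template i j k a b c d" using vec_with_values[OF dist sum] .
      have "?x \<noteq> 0"
      proof
        assume "?x = 0"
        then have "template i j k a b c d t = 0" for t using ev by (metis ev_0)
        from this[of i] this[of j] this[of l] show False
          using nz lm by (auto simp: template_def split: if_splits)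
      qed
      then show ?thesis using ev dist unfolding template_class_def by blast
    qed
    then show "f ` triples \<subseteq> template_class a b c d" by (auto simp: f_def triples_def)
    show "template_class a b c d \<subseteq> f ` triples"
    proof
      fix P assume "P \<in> template_class a b c d"
      then obtain x i j k where "P = pt x" and dist: "distinct [i, j, k]"
        and ev: "ev x = template i j k a b c d"
        unfolding template_class_def by blast
      moreover have "(i, j, k) \<in> triples" using dist by (simp add: triples_def)
      moreover have "f (i, j, k) = pt x"
        unfolding f_def prod.case ev[symmetric] by (simp flip: frame_expansion)
      ultimately show "P \<in> f ` triples" by (metis imageI)
    qed
  qed
  have "finite triples" using card_triples by (metis card.infinite zero_neq_numeral)
  have "(\<Sum>s\<in>triples. card {P \<in> template_class a b c d. f s = P}) = n * card (template_class a b c d)"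
  proof (rule sum_multicount)
    show "finite (template_class a b c d)" using \<open>finite triples\<close> by (simp flip: f)
    show "\<forall>P\<in>template_class a b c d. card {s \<in> triples. f s = P} = n"
    proof
      fix P assume "P \<in> template_class a b c d"
      then obtain i j k where P: "P = f (i, j, k)" and dist: "distinct [i, j, k]"
        by (auto simp: triples_def simp flip: f)
      have "{s \<in> triples. f s = P} = {(i', j', k') \<in> triples. \<exists>r. r \<noteq> 0 \<and> (\<forall>t. template i' j' k' a b c d t = r * template i j k a b c d t)}"
      proof -
        have "f (i', j', k') = P \<longleftrightarrow> (\<exists>r. r \<noteq> 0 \<and> (\<forall>t. template i' j' k' a b c d t = r * template i j k a b c d t))"
          if "distinct [i', j', k']" for i' j' k'
          by (simp only: P f_def prod.case pt_eq_iff_ev vec_with_values[OF that sum] vec_with_values[OF dist sum])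
        then show ?thesis by (auto simp: triples_def)
      qed
      then show "card {s \<in> triples. f s = P} = n" using fib[OF dist] by simp
    qed
  qed fact
  moreover have "{P \<in> template_class a b c d. f s = P} = {f s}" if "s \<in> triples" for s
    using that f by auto
  ultimately show ?thesis by (simp add: card_triples)
qed

text \<open>Turns the fibre condition into a finite disjunction over three scalars and five
  positions.\<close>

lemma template_proportional_iff:
  fixes f g :: "'a option \<Rightarrow> 'a"
  assumes "UNIV = {i, j, k, l, m}"
  shows "(\<exists>r. r \<noteq> 0 \<and> (\<forall>t. f t = r * g t)) \<longleftrightarrow>
    (\<exists>r\<in>{1, w, w + 1}. f i = r * g i \<and> f j = r * g j \<and> f k = r * g k \<and> f l = r * g l \<and> f m = r * g m)"
proof -
  have all: "(\<forall>t. P t) \<longleftrightarrow> P i \<and> P j \<and> P k \<and> P l \<and> P m" for P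
    using assms by (metis UNIV_I empty_iff insert_iff)
  show ?thesis unfolding all nonzero_scalar by blast
qed

lemma distinct5D:
  assumes "distinct [i, j, k, l, m]"
  shows "i \<noteq> j" "i \<noteq> k" "i \<noteq> l" "i \<noteq> m" "j \<noteq> i" "j \<noteq> k" "j \<noteq> l" "j \<noteq> m" "k \<noteq> i" "k \<noteq> j" "k \<noteq> l" "k \<noteq> m"
    "l \<noteq> i" "l \<noteq> j" "l \<noteq> k" "l \<noteq> m" "m \<noteq> i" "m \<noteq> j" "m \<noteq> k" "m \<noteq> l"
  using assms by auto

lemma template_values:
  assumes "distinct [i, j, k, l, m]"
  shows "template i j k a b c d i = a" "template i j k a b c d j = b" "template i j k a b c d k = c"
    "template i j k a b c d l = d" "template i j k a b c d m = d"
  by (simp_all add: template_def distinct5D[OF assms])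

text \<open>Scaling by \<open>w\<close> rotates the values 1, w, w + 1 cyclically, while the two
  zeros fix the set of the other three positions. Hence fibres of size 3.\<close>

lemma card_class_T: "card (template_class 1 w (w + 1) 0) = 20"
proof -
  have "card {(i', j', k') \<in> triples. \<exists>r. r \<noteq> 0 \<and>
      (\<forall>t. template i' j' k' 1 w (w + 1) 0 t = r * template i j k 1 w (w + 1) 0 t)} = 3"
    (is "card ?S = _") if dist: "distinct [i, j, k]" for i j k
  proof -
    obtain l m where lm: "distinct [i, j, k, l, m]" "UNIV = {i, j, k, l, m}"
      using five_points[OF dist] .
    have dom: "i' = i \<or> i' = j \<or> i' = k \<or> i' = l \<or> i' = m" for i' using lm(2) by blast
    have "s \<in> ?S \<longleftrightarrow> s \<in> {(i, j, k), (j, k, i), (k, i, j)}" for s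
    proof (cases s)
      case (fields i' j' k')
      show ?thesis
        unfolding fields triples_def mem_Collect_eq prod.case
          template_proportional_iff[OF lm(2)] template_values[OF lm(1)]
        using dom[of i'] dom[of j'] dom[of k']
        by (elim disjE; simp add: template_def w_sq distinct5D[OF lm(1)])
    qed
    then have "?S = {(i, j, k), (j, k, i), (k, i, j)}" by (rule set_eqI)
    then show ?thesis by (simp add: distinct5D[OF lm(1)])
  qed
  then have "3 * card (template_class 1 w (w + 1) 0) = 60"
    by (intro card_template_class) simp_all
  then show ?thesis by simp
qed

text \<open>The three zeros may be listed in any order, hence fibres of size 6.\<close>

lemma card_class_3: "card (template_class 0 0 0 1) = 10"
proof -
  have "card {(i', j', k') \<in> triples. \<exists>r. r \<noteq> 0 \<and>
      (\<forall>t. template i' j' k' 0 0 0 1 t = r * template i j k 0 0 0 1 t)} = 6"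
    (is "card ?S = _") if dist: "distinct [i, j, k]" for i j k
  proof -
    obtain l m where lm: "distinct [i, j, k, l, m]" "UNIV = {i, j, k, l, m}"
      using five_points[OF dist] .
    have dom: "i' = i \<or> i' = j \<or> i' = k \<or> i' = l \<or> i' = m" for i' using lm(2) by blast
    have "s \<in> ?S \<longleftrightarrow> s \<in> {(i, j, k), (i, k, j), (j, i, k), (j, k, i), (k, i, j), (k, j, i)}" for s
    proof (cases s)
      case (fields i' j' k')
      show ?thesis
        unfolding fields triples_def mem_Collect_eq prod.case
          template_proportional_iff[OF lm(2)] template_values[OF lm(1)]
        using dom[of i'] dom[of j'] dom[of k']
        by (elim disjE; simp add: template_def w_sq distinct5D[OF lm(1)])
    qed
    then have "?S = {(i, j, k), (i, k, j), (j, i, k), (j, k, i), (k, i, j), (k, j, i)}" by (rule set_eqI)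
    then show ?thesis by (simp add: distinct5D[OF lm(1)])
  qed
  then have "6 * card (template_class 0 0 0 1) = 60"
    by (intro card_template_class) simp_all
  then show ?thesis by simp
qed

text \<open>Only the scalar 1 maps the pair of values 1, w to itself, so just the two positions with
  value 1 can be exchanged.\<close>

lemma card_class_1: "card (template_class 0 1 1 w) = 30"
proof -
  have "card {(i', j', k') \<in> triples. \<exists>r. r \<noteq> 0 \<and>
      (\<forall>t. template i' j' k' 0 1 1 w t = r * template i j k 0 1 1 w t)} = 2"
    (is "card ?S = _") if dist: "distinct [i, j, k]" for i j k
  proof -
    obtain l m where lm: "distinct [i, j, k, l, m]" "UNIV = {i, j, k, l, m}"
      using five_points[OF dist] .
    have dom: "i' = i \<or> i' = j \<or> i' = k \<or> i' = l \<or> i' = m" for i' using lm(2) by blast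
    have "s \<in> ?S \<longleftrightarrow> s \<in> {(i, j, k), (i, k, j)}" for s
    proof (cases s)
      case (fields i' j' k')
      show ?thesis
        unfolding fields triples_def mem_Collect_eq prod.case
          template_proportional_iff[OF lm(2)] template_values[OF lm(1)]
        using dom[of i'] dom[of j'] dom[of k']
        by (elim disjE; simp add: template_def w_sq distinct5D[OF lm(1)])
    qed
    then have "?S = {(i, j, k), (i, k, j)}" by (rule set_eqI)
    then show ?thesis by (simp add: distinct5D[OF lm(1)])
  qed
  then have "2 * card (template_class 0 1 1 w) = 60"
    by (intro card_template_class) simp_all
  then show ?thesis by simp
qed

text \<open>The third value agrees with the repeated one, so the third position may be any of the
  three that carry 1.\<close>

lemma card_class_0: "card (template_class w (w + 1) 1 1) = 20"
proof -
  have "card {(i', j', k') \<in> triples. \<exists>r. r \<noteq> 0 \<and>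
      (\<forall>t. template i' j' k' w (w + 1) 1 1 t = r * template i j k w (w + 1) 1 1 t)} = 3"
    (is "card ?S = _") if dist: "distinct [i, j, k]" for i j k
  proof -
    obtain l m where lm: "distinct [i, j, k, l, m]" "UNIV = {i, j, k, l, m}"
      using five_points[OF dist] .
    have dom: "i' = i \<or> i' = j \<or> i' = k \<or> i' = l \<or> i' = m" for i' using lm(2) by blast
    have "s \<in> ?S \<longleftrightarrow> s \<in> {(i, j, k), (i, j, l), (i, j, m)}" for s
    proof (cases s)
      case (fields i' j' k')
      show ?thesis
        unfolding fields triples_def mem_Collect_eq prod.case
          template_proportional_iff[OF lm(2)] template_values[OF lm(1)]
        using dom[of i'] dom[of j'] dom[of k']
        by (elim disjE; simp add: template_def w_sq distinct5D[OF lm(1)])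
    qed
    then have "?S = {(i, j, k), (i, j, l), (i, j, m)}" by (rule set_eqI)
    then show ?thesis by (simp add: distinct5D[OF lm(1)])
  qed
  then have "3 * card (template_class w (w + 1) 1 1) = 60"
    by (intro card_template_class) simp_all
  then show ?thesis by simp
qed

section \<open>The classes as geometric types of points\<close>

lemma TC_eq_class: "TC = template_class 0 1 1 1"
proof
  show "TC \<subseteq> template_class 0 1 1 1"
  proof
    fix P :: "'a point" assume "P \<in> TC"
    then obtain i where P: "P = pt (frame i)" by (auto simp: mem_TC_iff)
    \<comment> \<open>The template \<open>0 1 1 1\<close> depends only on \<open>i\<close>; any two
      further positions complete the triple.\<close>
    have "card (UNIV - {i}) = 4" using card_option by (simp add: card_Diff_subset)
    then obtain A where "A \<subseteq> UNIV - {i}" "card A = 2"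
      using obtain_subset_with_card_n[of 2 "UNIV - {i}"] by auto
    then obtain j k where "distinct [i, j, k]" by (auto simp: card_2_iff)
    moreover have "ev (frame i) t = 1 * template i j k 0 1 1 1 t" for t
      by (simp add: ev_frame template_def)
    ultimately show "P \<in> template_class 0 1 1 1"
      unfolding P by (intro pt_mem_template_classI[where r = 1]) simp_all
  qed
  show "template_class 0 1 1 1 \<subseteq> TC"
  proof
    fix P assume "P \<in> template_class 0 1 1 1"
    then obtain x i j k where P: "P = pt x" and ev: "ev x = template i j k 0 1 1 1"
      unfolding template_class_def by blast
    have "x = frame i" by (rule ev_eqI) (simp add: ev ev_frame template_def)
    then show "P \<in> TC" by (auto simp: P mem_TC_iff)
  qed
qed

text \<open>On the tangent at \<open>s\<close> the form has a double root at \<open>s\<close>. Off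
  the cubic the remaining linear factor has its root elsewhere, which makes exactly two
  roots.\<close>

lemma card_zeros_tangent:
  fixes P :: "'a point"
  assumes "P \<in> Points" "P \<in> tangent s" "P \<notin> TC"
  shows "card {t. P \<in> osc t} = 2"
proof (cases s)
  case None
  then obtain a b where P: "P = pt (a *s vec4 1 0 0 0 + b *s vec4 0 1 0 0)"
    and nz: "a *s vec4 1 0 0 0 + b *s vec4 0 1 0 0 \<noteq> 0"
    using assms(2) by (auto simp: line_def)
  define x where "x = a *s vec4 1 0 0 0 + b *s vec4 0 1 0 0"
  have b: "b \<noteq> 0"
  proof
    assume "b = 0"
    then have "P = pt (frame None)" using nz by (simp add: P pt_scale scale_eq_0)
    then show False using assms(3) mem_TC_iff by blast
  qed
  have "ev x t = 0 \<longleftrightarrow> t \<in> {None, Some (a / b)}" for t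
    using b by (cases t) (auto simp: x_def field_simps)
  then have "{t. P \<in> osc t} = {None, Some (a / b)}"
    using nz unfolding P x_def[symmetric] by (auto simp: pt_mem_osc)
  then show ?thesis by simp
next
  case (Some c)
  \<comment> \<open>Characteristic 2 turns the direction (3c^2, 2c, 1, 0) into (c^2, 0, 1,
    0).\<close>
  then obtain a b where P: "P = pt (a *s vec4 (c^3) (c^2) c 1 + b *s vec4 (c^2) 0 1 0)"
    and nz: "a *s vec4 (c^3) (c^2) c 1 + b *s vec4 (c^2) 0 1 0 \<noteq> 0"
    using assms(2) by (auto simp: line_def)
  define x where "x = a *s vec4 (c^3) (c^2) c 1 + b *s vec4 (c^2) 0 1 0"
  have b: "b \<noteq> 0"
  proof
    assume "b = 0"
    then have "P = pt (frame (Some c))" using nz by (simp add: P pt_scale scale_eq_0)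
    then show False using assms(3) mem_TC_iff by blast
  qed
  have ev_Some: "ev x (Some t) = (t + c) ^ 2 * (a * (t + c) + b)" for t
    by (simp add: x_def arith_simps)
  have root: "a * (t + c) + b = 0 \<longleftrightarrow> a \<noteq> 0 \<and> t = c + b / a" for t
    using b by (auto simp: field_simps)
  \<comment> \<open>For \<open>a = 0\<close> the linear factor is constant on the affine part and
    the simple root sits at infinity.\<close>
  have "ev x t = 0 \<longleftrightarrow> t \<in> {Some c, if a = 0 then None else Some (c + b / a)}" for t
  proof (cases t)
    case None
    then show ?thesis by (simp add: x_def)
  next
    case (Some r)
    then show ?thesis unfolding Some ev_Some by (simp add: root del: add_eq_0_iff_eq) auto
  qed
  then have "{t. P \<in> osc t} = {Some c, if a = 0 then None else Some (c + b / a)}"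
    using nz unfolding P x_def[symmetric] by (auto simp: pt_mem_osc)
  then show ?thesis using b by simp
qed

text \<open>The values \<open>ev x\<close> are those of a binary cubic form with coefficients \<open>x\<close>. If it has exactly two
  roots over the field, one of them is double, and \<open>x\<close> lies on the tangent at the double root.\<close>

lemma tangent_of_two_zeros:
  fixes x :: "'a vec4"
  assumes "x \<noteq> 0" "{t. ev x t = 0} = {s, t}" "s \<noteq> t"
  shows "\<exists>r. pt x \<in> tangent r"
proof -
  have tangentI: "pt x \<in> line u v" if "x = a *s u + b *s v" for a b u v
    using that assms(1) unfolding line_def by blast
  have zero: "ev x r = 0 \<longleftrightarrow> r = s \<or> r = t" for r using assms(2) by blast
  \<comment> \<open>With a root at infinity the form drops to degree at most two. If
    \<open>x $ 3\<close> vanishes too, infinity is the double root; otherwise \<open>m\<close>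
    is.\<close>
  have inf: "\<exists>r. pt x \<in> tangent r" if z: "\<And>r. ev x r = 0 \<longleftrightarrow> r = None \<or> r = Some m" for m
  proof -
    have x4: "x $ 4 = 0" using z[of None] by simp
    have xm: "x $ 1 = x $ 2 * m + x $ 3 * m^2" using z[of "Some m"] x4 by (simp add: add.assoc)
    show ?thesis
    proof (cases "x $ 3 = 0")
      case True
      then have "pt x \<in> tangent None"
        using x4 by (auto intro!: tangentI[of "x $ 1" _ "x $ 2"] simp: vec4_eq_iff)
      then show ?thesis by blast
    next
      case False
      \<comment> \<open>\<open>q\<close> is the sum of the roots of the quadratic, so
        \<open>m + q\<close> is the second root and must coincide with \<open>m\<close>.\<close>
      define q where "q = x $ 2 / x $ 3"
      have x2: "x $ 2 = x $ 3 * q" using False by (simp add: q_def)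
      have "ev x (Some (m + q)) = 0"
        by (simp add: x4 xm x2 power2_eq_square algebra_simps)
      then have "Some (m + q) = Some m" using z by blast
      then have "x $ 2 = 0" by (simp add: x2)
      then have "pt x \<in> tangent (Some m)"
        using x4 xm by (auto intro!: tangentI[of 0 _ "x $ 3"] simp: vec4_eq_iff)
      then show ?thesis by blast
    qed
  qed
  \<comment> \<open>When \<open>x $ 4\<close> is nonzero, the first premise says that the three
    roots sum to \<open>b\<close>; as \<open>a\<close> and \<open>b\<close> are roots, the third one
    is \<open>a\<close> again.\<close>
  have double: "pt x \<in> tangent (Some a)"
    if "x $ 3 = x $ 4 * b" "ev x (Some a) = 0" "ev x (Some b) = 0" "a \<noteq> b" for a b
  proof -
    have x1: "x $ 1 = x $ 2 * b"
      using that(1,3) by (simp add: power2_eq_square power3_eq_cube mult.assoc add.assoc)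
    have "(x $ 2 + x $ 4 * a^2) * (a + b) = ev x (Some a)"
      by (simp add: x1 that(1) power2_eq_square power3_eq_cube algebra_simps)
    then have "x $ 2 = x $ 4 * a^2" unfolding that(2) using that(4) by simp
    then show ?thesis using that(1) x1
      by (auto intro!: tangentI[of "x $ 4" _ "x $ 4 * (a + b)"]
          simp: vec4_eq_iff power2_eq_square power3_eq_cube algebra_simps)
  qed
  show ?thesis
  proof (cases s)
    case None
    then obtain m where "t = Some m" using assms(3) by (cases t) auto
    then show ?thesis using inf zero None by blast
  next
    case (Some a)
    note s = this
    show ?thesis
    proof (cases t)
      case None
      then show ?thesis using inf zero s by blast
    next
      case (Some b)
      have x4: "x $ 4 \<noteq> 0" using zero[of None] s Some by simp
      have za: "ev x (Some a) = 0" using zero[of s] unfolding s by blast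
      have zb: "ev x (Some b) = 0" using zero[of t] unfolding Some by blast
      have "a \<noteq> b" using assms(3) s Some by simp
      \<comment> \<open>The third root, read off from the sum of the roots
        \<open>x $ 3 / x $ 4\<close>. The identities that follow recover the other coefficients by
        Vieta.\<close>
      define r where "r = a + b + x $ 3 / x $ 4"
      have "a + b + r = x $ 3 / x $ 4" by (simp add: r_def add.assoc)
      then have x3: "x $ 3 = x $ 4 * (a + b + r)" using x4 by simp
      have "(x $ 2 + x $ 4 * (a * b + r * (a + b))) * (a + b) = ev x (Some a) + ev x (Some b)"
        by (simp add: x3 power2_eq_square power3_eq_cube algebra_simps)
      then have x2: "x $ 2 = x $ 4 * (a * b + r * (a + b))" unfolding za zb using \<open>a \<noteq> b\<close> by simp
      have "x $ 1 + x $ 4 * a * b * r = ev x (Some a)"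
        by (simp add: x2 x3 power2_eq_square power3_eq_cube algebra_simps)
      then have x1: "x $ 1 = x $ 4 * a * b * r" unfolding za by simp
      have "ev x (Some r) = 0"
        by (simp add: x1 x2 x3 power2_eq_square power3_eq_cube algebra_simps)
      then have "Some r = s \<or> Some r = t" using zero by blast
      then have "r = a \<or> r = b" using s Some by simp
      then show ?thesis
      proof
        assume "r = a"
        then have "x $ 3 = x $ 4 * b" by (simp add: x3 add.commute add.left_commute)
        then show ?thesis using double za zb \<open>a \<noteq> b\<close> by blast
      next
        assume "r = b"
        then have "x $ 3 = x $ 4 * a" by (simp add: x3 add.commute add.left_commute)
        then show ?thesis using double za zb \<open>a \<noteq> b\<close> by blast
      qed
    qed
  qed
qed

text \<open>Both sides consist of the points on exactly two osculating planes: the other four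
  classes have 1, 3, 1 and 0.\<close>

lemma T_points_eq_class: "T_points = template_class 1 w (w + 1) 0"
proof
  show "T_points \<subseteq> template_class 1 w (w + 1) 0"
  proof
    fix P :: "'a point" assume "P \<in> T_points"
    then have "P \<in> Points" "card {t. P \<in> osc t} = 2"
      using card_zeros_tangent by (auto simp: T_points_def)
    then show "P \<in> template_class 1 w (w + 1) 0"
      using Points_cases[of P] by (auto dest: card_osc_template_class)
  qed
  show "template_class 1 w (w + 1) 0 \<subseteq> T_points"
  proof
    fix P assume P: "P \<in> template_class 1 w (w + 1) 0"
    then have pts: "P \<in> Points" using template_class_subset_Points by blast
    then obtain x where x: "P = pt x" "x \<noteq> 0" by (auto simp: Points_def)
    have two: "card {t. P \<in> osc t} = 2" using card_osc_template_class[OF P] by simp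
    then obtain s t where "{t. ev x t = 0} = {s, t}" "s \<noteq> t"
      using x by (auto simp: pt_mem_osc card_2_iff)
    then have "\<exists>r. P \<in> tangent r" using tangent_of_two_zeros x by blast
    moreover have "P \<notin> TC" using two by (auto simp: TC_eq_class dest: card_osc_template_class)
    ultimately show "P \<in> T_points" using pts by (simp add: T_points_def)
  qed
qed

text \<open>Both classes have a single zero, so counting osculating planes cannot separate them. The
  four other values are all equal in the first class but not in the second.\<close>

lemma classes_disjoint: "P \<in> template_class 0 1 1 1 \<Longrightarrow> P \<notin> template_class 0 1 1 w"
proof
  assume "P \<in> template_class 0 1 1 1"
  then obtain s where s: "P = pt (frame s)" by (auto simp: mem_TC_iff simp flip: TC_eq_class)
  assume "P \<in> template_class 0 1 1 w"
  then obtain x i j k where "P = pt x" and dist: "distinct [i, j, k]" and ev: "ev x = template i j k 0 1 1 w"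
    unfolding template_class_def by blast
  then have "pt x = pt (frame s)" using s by simp
  then obtain r where "r \<noteq> 0" and r: "\<And>t. template i j k 0 1 1 w t = r * of_bool (t \<noteq> s)"
    unfolding pt_eq_iff_ev ev_frame ev by blast
  obtain l m where lm: "distinct [i, j, k, l, m]" using five_points[OF dist] by metis
  note vals = r[of i] r[of j] r[of l]
  have "s = i" using vals(1) \<open>r \<noteq> 0\<close> unfolding template_values[OF lm] by simp
  then have "r = 1" "r = w"
    using vals(2,3) unfolding template_values[OF lm] by (simp_all add: distinct5D[OF lm])
  then show False by simp
qed

lemma card_osc_classes:
  "P \<in> template_class 0 1 1 1 \<Longrightarrow> card {t. P \<in> osc t} = 1"
  "P \<in> template_class 0 0 0 1 \<Longrightarrow> card {t. P \<in> osc t} = 3"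
  "P \<in> template_class 0 1 1 w \<Longrightarrow> card {t. P \<in> osc t} = 1"
  "P \<in> template_class 1 w (w + 1) 0 \<Longrightarrow> card {t. P \<in> osc t} = 2"
  "P \<in> template_class w (w + 1) 1 1 \<Longrightarrow> card {t. P \<in> osc t} = 0"
  by (drule card_osc_template_class, simp)+

lemma classes_by_card_osc:
  "{P \<in> Points. card {t. P \<in> osc t} = 0} = template_class w (w + 1) 1 1"
  "{P \<in> Points. card {t. P \<in> osc t} = 2} = template_class 1 w (w + 1) 0"
  "{P \<in> Points. card {t. P \<in> osc t} = 3} = template_class 0 0 0 1"
  "{P \<in> Points. P \<notin> TC \<and> card {t. P \<in> osc t} = 1} = template_class 0 1 1 w"
proof -
  note count = card_osc_classes
  have Points: "P \<in> Points \<longleftrightarrow> P \<in> template_class 0 1 1 1 \<or> P \<in> template_class 0 0 0 1 \<or> P \<in> template_class 0 1 1 w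
    \<or> P \<in> template_class 1 w (w + 1) 0 \<or> P \<in> template_class w (w + 1) 1 1" for P
    using Points_cases template_class_subset_Points by blast
  have "card {t. P \<in> osc t} = 0 \<longleftrightarrow> P \<in> template_class w (w + 1) 1 1"
    "card {t. P \<in> osc t} = 2 \<longleftrightarrow> P \<in> template_class 1 w (w + 1) 0"
    "card {t. P \<in> osc t} = 3 \<longleftrightarrow> P \<in> template_class 0 0 0 1"
    "P \<notin> TC \<and> card {t. P \<in> osc t} = 1 \<longleftrightarrow> P \<in> template_class 0 1 1 w"
    if "P \<in> Points" for P
    using that[unfolded Points] count[of P] classes_disjoint[of P] unfolding TC_eq_class by auto
  then show "{P \<in> Points. card {t. P \<in> osc t} = 0} = template_class w (w + 1) 1 1"
    "{P \<in> Points. card {t. P \<in> osc t} = 2} = template_class 1 w (w + 1) 0"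
    "{P \<in> Points. card {t. P \<in> osc t} = 3} = template_class 0 0 0 1"
    "{P \<in> Points. P \<notin> TC \<and> card {t. P \<in> osc t} = 1} = template_class 0 1 1 w"
    using template_class_subset_Points by blast+
qed

lemma muGamma_points_eq:
  assumes "\<mu> \<noteq> 2"
  shows "muGamma_points \<mu> = {P :: 'a point. P \<in> Points \<and> P \<notin> TC \<and> card {t. P \<in> osc t} = \<mu>}"
  using assms by (auto simp: muGamma_points_def dest: card_zeros_tangent)

lemma muGamma_points_eq_class:
  "muGamma_points 3 = template_class 0 0 0 1"
  "muGamma_points 1 = template_class 0 1 1 w"
  "muGamma_points 0 = template_class w (w + 1) 1 1"
proof -
  have TC: "P \<in> TC \<Longrightarrow> card {t. P \<in> osc t} = 1" for P :: "'a point"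
    by (rule card_osc_classes(1)) (simp add: TC_eq_class)
  show "muGamma_points 3 = template_class 0 0 0 1" "muGamma_points 0 = template_class w (w + 1) 1 1"
    unfolding classes_by_card_osc[symmetric] by (auto simp: muGamma_points_eq dest!: TC)
  show "muGamma_points 1 = template_class 0 1 1 w"
    unfolding classes_by_card_osc[symmetric] by (rule muGamma_points_eq) simp
qed

end

subsection \<open>The polarity\<close>

text \<open>In characteristic 2 the signs of the null polarity of the twisted cubic disappear.\<close>

definition polar :: "'a::field point \<Rightarrow> 'a point set" where
  "polar P = (\<Union>x\<in>P. plane (rev4 x))"

text \<open>All representatives of a point define the same plane, so the union in
  \<open>polar\<close> is that one plane.\<close>

lemma polar_pt: "polar (pt x) = plane (rev4 x)"
proof -
  have "plane (rev4 y) = plane (rev4 x)" if "y \<in> pt x" for y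
    using that by (auto simp: pt_def rev4_scale plane_scale)
  then show ?thesis unfolding polar_def using mem_pt_self by blast
qed

lemma polar_image_Points: "polar ` Points = Planes"
proof
  show "polar ` Points \<subseteq> Planes" by (auto simp: Points_def Planes_def polar_pt)
  have "plane c = polar (pt (rev4 c))" for c :: "'a vec4" by (simp add: polar_pt)
  then show "(Planes :: 'a point set set) \<subseteq> polar ` Points"
    unfolding Planes_def Points_def using rev4_eq_0 by blast
qed

lemma inj_on_polar: "inj_on polar Points"
proof (rule inj_onI)
  fix P Q :: "'a point" assume "P \<in> Points" "Q \<in> Points" "polar P = polar Q"
  then obtain x y where xy: "P = pt x" "Q = pt y" "x \<noteq> 0" "y \<noteq> 0" "plane (rev4 x) = plane (rev4 y)"
    by (auto simp: Points_def polar_pt)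
  then obtain a where "a \<noteq> 0" "rev4 x = a *s rev4 y" using plane_eqD[OF xy(5)] by auto
  then have "a \<noteq> 0" "x = a *s y" by (metis rev4_rev4 rev4_scale)+
  then show "P = Q" by (simp add: xy pt_scale)
qed

context quaternary_field
begin

text \<open>\<open>M\<close> permutes the values and scales them by \<open>l\<close>, so the dot
  product of values is multiplied by \<open>l * l\<close>.\<close>

lemma dot4_rev4_Gq:
  fixes x y :: "'a vec4"
  assumes "M \<in> Gq"
  shows "dot4 (rev4 (x v* M)) (y v* M) = 0 \<longleftrightarrow> dot4 (rev4 x) y = 0"
proof -
  obtain \<sigma> l where \<sigma>: "bij \<sigma>" "l \<noteq> 0" "\<And>t. frame t v* M = l *s frame (\<sigma> t)"
    using Gq_permutes_frame[OF assms] by metis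
  have "dot4 (rev4 (x v* M)) (y v* M) = (\<Sum>t\<in>UNIV. ev (x v* M) (\<sigma> t) * ev (y v* M) (\<sigma> t))"
    unfolding dot4_rev4 by (rule sum.reindex_bij_betw[symmetric]) (rule \<sigma>(1))
  also have "\<dots> = l * l * dot4 (rev4 x) y"
    by (simp only: ev_permuted[OF \<sigma>(1,3)] dot4_rev4 sum_distrib_left mult_ac)
  finally show ?thesis using \<sigma>(2) by simp
qed

lemma plmap_polar:
  fixes P :: "'a point"
  assumes M: "M \<in> Gq" and P: "P \<in> Points"
  shows "plmap M (polar P) = polar (pmap M P)"
proof -
  obtain x where x: "P = pt x" "x \<noteq> 0" using P by (auto simp: Points_def)
  have "plmap M (polar P) = {pt (y v* M) | y. y \<noteq> 0 \<and> dot4 (rev4 x) y = 0}"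
    unfolding plmap_def x(1) polar_pt plane_def by (auto simp: image_def pmap_pt)
  also have "\<dots> = {pt (y v* M) | y. y v* M \<noteq> 0 \<and> dot4 (rev4 (x v* M)) (y v* M) = 0}"
    by (simp only: dot4_rev4_Gq[OF M] vector_matrix_eq_0_iff[OF M])
  also have "\<dots> = {pt z | z. z \<noteq> 0 \<and> dot4 (rev4 (x v* M)) z = 0}"
  proof -
    \<comment> \<open>Surjectivity of \<open>M\<close> allows the substitution of \<open>z\<close>
      for \<open>y v* M\<close> in the description of the image plane.\<close>
    have "z \<in> range (\<lambda>y. y v* M)" for z
    proof -
      have "invertible M" using M by (simp add: Gq_def)
      then obtain N where "N ** M = mat 1" unfolding invertible_def by blast
      then have "z = (z v* N) v* M" by (simp add: vector_matrix_mul_assoc)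
      then show ?thesis by blast
    qed
    then have surj: "surj (\<lambda>y. y v* M)" by blast
    have "{z. Q z} = (\<lambda>y. y v* M) ` {y. Q (y v* M)}" for Q
      using surj_image_vimage_eq[OF surj, of "Collect Q"] by (simp add: vimage_def)
    from this[of "\<lambda>z. z \<noteq> 0 \<and> dot4 (rev4 (x v* M)) z = 0"] show ?thesis
      unfolding setcompr_eq_image by (simp add: image_image)
  qed
  finally show ?thesis by (simp add: x(1) pmap_pt polar_pt plane_def)
qed

lemma orbit_pl_polar:
  fixes P :: "'a point"
  assumes "G \<subseteq> Gq" "P \<in> Points"
  shows "orbit_pl G (polar P) = polar ` orbit_pt G P"
proof -
  have "plmap M (polar P) = polar (pmap M P)" if "M \<in> G" for M
    using plmap_polar assms that by blast
  then show ?thesis unfolding orbit_pl_def orbit_pt_def by (auto intro!: imageI)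
qed

lemma Gamma_planes_eq: "Gamma_planes = polar ` (TC :: 'a point set)"
  unfolding Gamma_planes_def TC_def image_image by (simp add: osc_eq_plane Pc_eq polar_pt)

text \<open>Reciprocity: \<open>B\<close> is symmetric, so a point of the cubic lies on the polar
  plane of \<open>P\<close> exactly when \<open>P\<close> lies on the osculating plane at that
  point.\<close>

lemma card_polar_Int_TC:
  fixes P :: "'a point"
  assumes "P \<in> Points"
  shows "card (polar P \<inter> TC) = card {t. P \<in> osc t}"
proof -
  obtain x where x: "P = pt x" "x \<noteq> 0" using assms by (auto simp: Points_def)
  have "polar P \<inter> TC = Pc ` {t. P \<in> osc t}"
    by (auto simp: x(1) polar_pt mem_TC_iff pt_mem_plane dot4_rev4_frame pt_mem_osc[OF x(2)] Pc_eq)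
  then show ?thesis by (simp add: card_image inj_on_subset[OF inj_Pc])
qed

lemma polar_image_filter:
  assumes "\<And>P. P \<in> Points \<Longrightarrow> Q (polar P) \<longleftrightarrow> R P"
  shows "{S \<in> Planes. Q S} = polar ` {P \<in> Points. R P}"
  unfolding polar_image_Points[symmetric] using assms by auto

text \<open>By reciprocity the number of points of the cubic on a plane is the number of osculating
  planes through its pole. Poles on the cubic give the \<Gamma>-planes, which separates the two
  kinds of planes with one point.\<close>

lemma plane_classes:
  "dC_planes 0 = polar ` template_class w (w + 1) 1 1"
  "dC_planes 2 = polar ` template_class 1 w (w + 1) 0"
  "dC_planes 3 = polar ` template_class 0 0 0 1"
  "one_bar_planes = polar ` template_class 0 1 1 w"
  unfolding dC_planes_def one_bar_planes_def classes_by_card_osc[symmetric]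
  by (rule polar_image_filter,
      simp add: card_polar_Int_TC Gamma_planes_eq inj_on_image_mem_iff[OF inj_on_polar _ TC_subset_Points])+

end

theorem theorem6p2:
  fixes q :: "'a::field itself"
  assumes "CARD('a) = 4"
  shows "(\<forall>S \<in> (Planes :: 'a point set set). orbit_pl Gq S = orbit_pl Gq_star S)
       \<and> (\<forall>P \<in> (Points :: 'a point set). orbit_pt Gq P = orbit_pt Gq_star P)
       \<and> {orbit_pl Gq S | S. S \<in> (Planes :: 'a point set set)}
            = {Gamma_planes, dC_planes 2, dC_planes 3, one_bar_planes, dC_planes 0}
       \<and> card (Gamma_planes :: 'a point set set) = 5
       \<and> card (dC_planes 2 :: 'a point set set) = 20
       \<and> card (dC_planes 3 :: 'a point set set) = 10
       \<and> card (one_bar_planes :: 'a point set set) = 30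
       \<and> card (dC_planes 0 :: 'a point set set) = 20
       \<and> {orbit_pt Gq P | P. P \<in> (Points :: 'a point set)}
            = {TC, T_points, muGamma_points 3, muGamma_points 1, muGamma_points 0}
       \<and> card (TC :: 'a point set) = 5
       \<and> card (T_points :: 'a point set) = 20
       \<and> card (muGamma_points 3 :: 'a point set) = 10
       \<and> card (muGamma_points 1 :: 'a point set) = 30
       \<and> card (muGamma_points 0 :: 'a point set) = 20"
proof -
  obtain w :: 'a where "quaternary_field w" using quaternary_field_exists[OF assms] by blast
  then interpret quaternary_field w .
  have points: "orbit_pt Gq P = orbit_pt Gq_star P" if "P \<in> Points" for P :: "'a point"
    using Points_cases[OF that] by (elim UnE) (simp_all add: orbit_template_class)
  have planes: "orbit_pl Gq S = orbit_pl Gq_star S" if "S \<in> Planes" for S :: "'a point set"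
  proof -
    obtain P where "S = polar P" "P \<in> Points" using \<open>S \<in> Planes\<close> polar_image_Points by blast
    then show ?thesis
      using points[of P] orbit_pl_polar[OF subset_refl, of P] orbit_pl_polar[OF Gq_star_subset_Gq, of P] by simp
  qed
  let ?classes = "{TC, T_points, muGamma_points 3, muGamma_points 1, muGamma_points 0 :: 'a point set}"
  have classes: "orbit_pt Gq ` Points = ?classes"
  proof
    show "orbit_pt Gq ` Points \<subseteq> ?classes"
    proof (rule image_subsetI)
      fix P :: "'a point" assume "P \<in> Points"
      from Points_cases[OF this] show "orbit_pt Gq P \<in> ?classes"
        unfolding TC_eq_class T_points_eq_class muGamma_points_eq_class
        by (elim UnE) (simp_all add: orbit_template_class(1))
    qed
    \<comment> \<open>Each of the five templates meets these two conditions, so every class is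
      nonempty and occurs as an orbit.\<close>
    have "template_class a b c d \<in> orbit_pt Gq ` Points"
      if nz: "a + b + c = 0" "a \<noteq> 0 \<or> b \<noteq> 0 \<or> d \<noteq> 0" for a b c d
    proof -
      obtain P where "P \<in> template_class a b c d" using template_class_nonempty[OF nz] by blast
      then have "orbit_pt Gq P = template_class a b c d" "P \<in> Points"
        using orbit_template_class(1) template_class_subset_Points by blast+
      then show ?thesis by (metis imageI)
    qed
    then show "?classes \<subseteq> orbit_pt Gq ` Points"
      unfolding TC_eq_class T_points_eq_class muGamma_points_eq_class by simp
  qed
  \<comment> \<open>The polarity commutes with \<open>Gq\<close>, so the plane orbits are the polar
    images of the point orbits.\<close>
  have "orbit_pl Gq ` (Planes :: 'a point set set) = image polar ` orbit_pt Gq ` Points"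
    unfolding polar_image_Points[symmetric] image_image
    by (intro image_cong) (simp_all add: orbit_pl_polar[OF subset_refl])
  also have "\<dots> = {Gamma_planes, dC_planes 2, dC_planes 3, one_bar_planes, dC_planes 0}"
    by (simp only: classes image_insert image_empty Gamma_planes_eq plane_classes
        T_points_eq_class muGamma_points_eq_class)
  finally have plane_orbits: "orbit_pl Gq ` (Planes :: 'a point set set)
      = {Gamma_planes, dC_planes 2, dC_planes 3, one_bar_planes, dC_planes 0}" .
  have card_polar: "card (polar ` A) = card A" if "A \<subseteq> Points" for A :: "'a point set"
    using that inj_on_polar by (metis card_image inj_on_subset)
  have card_TC: "card (TC :: 'a point set) = 5"
    by (simp add: TC_def card_image inj_Pc card_option)
  have "{orbit_pl Gq S | S. S \<in> (Planes :: 'a point set set)}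
      = {Gamma_planes, dC_planes 2, dC_planes 3, one_bar_planes, dC_planes 0}"
    using plane_orbits by (simp only: Setcompr_eq_image)
  moreover have "{orbit_pt Gq P | P. P \<in> (Points :: 'a point set)} = ?classes"
    using classes by (simp only: Setcompr_eq_image)
  moreover have "card (T_points :: 'a point set) = 20" "card (muGamma_points 3 :: 'a point set) = 10"
    "card (muGamma_points 1 :: 'a point set) = 30" "card (muGamma_points 0 :: 'a point set) = 20"
    by (simp_all only: T_points_eq_class muGamma_points_eq_class card_class_T card_class_3 card_class_1 card_class_0)
  moreover have "card (Gamma_planes :: 'a point set set) = 5" "card (dC_planes 2 :: 'a point set set) = 20"
    "card (dC_planes 3 :: 'a point set set) = 10" "card (one_bar_planes :: 'a point set set) = 30"
    "card (dC_planes 0 :: 'a point set set) = 20"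
    by (simp_all only: Gamma_planes_eq plane_classes card_polar TC_subset_Points template_class_subset_Points
        card_TC card_class_T card_class_3 card_class_1 card_class_0)
  ultimately show ?thesis
    using card_TC by (intro conjI ballI) (erule planes points | assumption)+
qed

end
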